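(* Let $\hat g(n;d)$ be the number of $r$-regular bipartite multigraphs on $(U,V)$ whose largest planar subgraph has at most $d$ edges. Then: (i) $\hat g(n;d)$ equals the number of ordered pairs $(P,Q)$ of standard Young tableaux of the same shape, both in $T([rn];d)$ and both satisfying Condition $(\hat T)$: for each $i\in[n]$ and $1\le s<r$, the row containing $r(i-1)+s+1$ is weakly above the row containing $r(i-1)+s$. (ii) $\hat g(n;d)=\sum_{\pi\in S_d}\operatorname{sgn}(\pi)\,|\widehat W'(d,2rn;T(\pi))|$, where $\widehat W'(d,2rn;T(\pi))$ is the set of walks in $W^*(d,2rn;T(\pi))$ with $a_{u^s}<a_{u^{s+1}}$ and $b_{v^s}<b_{v^{s+1}}$ for all $u\in U$, $v\in V$, $1\le s<r$.
   Context: Fix integers $n,r\ge 1$. Let $U=\{u_1,\dots,u_n\}$, $V=\{v_1,\dots,v_n\}$ be disjoint sets ordered by $u_1\prec\cdots\prec u_n$, $v_1\prec\cdots\prec v_n$. An $r$-regular bipartite multigraph on $(U,V)$ is a multiset of edges $uv$ ($u\in U,v\in V$) in which every vertex has degree $r$ (equivalently an $n\times n$ nonnegative integer matrix with all row and column sums $r$). A planar subgraph of such a multigraph $G$ is a sub-multiset of its edges (parallel copies counted separately) any two of which, $uv$ and $u'v'$, satisfy ($u\preceq u'$ and $v\preceq v'$) or ($u'\preceq u$ and $v'\preceq v$); i.e., a set of non-crossing edges which may share endpoints. $T([m];d)$ denotes the set of standard Young tableaux whose entries are exactly $1,\dots,m$ and which have at most $d$ columns (rows are numbered from top to bottom, row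 $i$ above row $i+1$). Walks: a walk of length $2m$ in $\mathbb Z^d$ from the origin whose first $m$ steps are positive and last $m$ steps negative is written $a_1\cdots a_m|b_1\cdots b_m$, $a_i,b_i\in[d]$, with steps $e_{a_1},\dots,e_{a_m},-e_{b_1},\dots,-e_{b_m}$; $W^*(d,2m;P)$ is the set of such walks ending in $P$. With $m=rn$, write $a_{u_i^s}=a_{r(i-1)+s}$ and $b_{v_i^s}=b_{r(i-1)+s}$. For a permutation $\pi$ of $[d]$, $T(\pi)=(1-\pi(1),\dots,d-\pi(d))$. *)

theory Defs
  imports Main "HOL-Combinatorics.Permutations"
begin

text \<open>An r-regular bipartite multigraph on (U,V), U = {u_1..u_n}, V = {v_1..v_n}, is encoded
  as its multiplicity matrix M: M i j = number of parallel edges u_i v_j (indices 1..n),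
  zero outside {1..n} x {1..n}.\<close>
definition reg_bip_multigraph :: "nat \<Rightarrow> nat \<Rightarrow> (nat \<Rightarrow> nat \<Rightarrow> nat) \<Rightarrow> bool" where
  "reg_bip_multigraph n r M \<longleftrightarrow>
     (\<forall>i j. M i j \<noteq> 0 \<longrightarrow> i \<in> {1..n} \<and> j \<in> {1..n}) \<and>
     (\<forall>i\<in>{1..n}. (\<Sum>j=1..n. M i j) = r) \<and>
     (\<forall>j\<in>{1..n}. (\<Sum>i=1..n. M i j) = r)"

text \<open>A planar subgraph: a sub-multiset S of the edges of M (S i j copies of u_i v_j),
  any two edges of which are non-crossing.\<close>
definition planar_subgraph :: "(nat \<Rightarrow> nat \<Rightarrow> nat) \<Rightarrow> (nat \<Rightarrow> nat \<Rightarrow> nat) \<Rightarrow> bool" where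
  "planar_subgraph M S \<longleftrightarrow>
     (\<forall>i j. S i j \<le> M i j) \<and>
     (\<forall>i j i' j'. 0 < S i j \<and> 0 < S i' j' \<longrightarrow> (i \<le> i' \<and> j \<le> j') \<or> (i' \<le> i \<and> j' \<le> j))"

definition num_edges :: "nat \<Rightarrow> (nat \<Rightarrow> nat \<Rightarrow> nat) \<Rightarrow> nat" where
  "num_edges n S = (\<Sum>i=1..n. \<Sum>j=1..n. S i j)"

definition g_hat :: "nat \<Rightarrow> nat \<Rightarrow> nat \<Rightarrow> nat" where
  "g_hat n r d = card {M. reg_bip_multigraph n r M \<and>
       (\<forall>S. planar_subgraph M S \<longrightarrow> num_edges n S \<le> d)}"

text \<open>Young diagrams: a partition is a weakly decreasing list of positive row lengths;
  rows are indexed 0,1,.. from top to bottom, columns 0,1,.. from left.\<close>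
definition is_partition :: "nat list \<Rightarrow> bool" where
  "is_partition la \<longleftrightarrow> sorted_wrt (\<ge>) la \<and> 0 \<notin> set la"

definition cells :: "nat list \<Rightarrow> (nat \<times> nat) set" where
  "cells la = {(i, j). i < length la \<and> j < la ! i}"

definition syt :: "nat \<Rightarrow> nat \<Rightarrow> nat list \<Rightarrow> (nat \<Rightarrow> nat \<Rightarrow> nat) \<Rightarrow> bool" where
  "syt m d la T \<longleftrightarrow>
     is_partition la \<and>
     (\<forall>i < length la. la ! i \<le> d) \<and>
     bij_betw (\<lambda>(i, j). T i j) (cells la) {1..m} \<and>
     (\<forall>i j. (i, j) \<notin> cells la \<longrightarrow> T i j = 0) \<and>
     (\<forall>i j. (i, j + 1) \<in> cells la \<longrightarrow> T i j < T i (j + 1)) \<and>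
     (\<forall>i j. (i + 1, j) \<in> cells la \<longrightarrow> T i j < T (i + 1) j)"

definition cond_T_hat :: "nat \<Rightarrow> nat \<Rightarrow> (nat \<Rightarrow> nat \<Rightarrow> nat) \<Rightarrow> bool" where
  "cond_T_hat n r T \<longleftrightarrow>
     (\<forall>i\<in>{1..n}. \<forall>s. 1 \<le> s \<and> s < r \<longrightarrow>
        (\<forall>x y x' y'. T x y = r * (i - 1) + s \<and> T x' y' = r * (i - 1) + s + 1 \<longrightarrow> x' \<le> x))"

text \<open>W*(d, 2m; P): walks a_1..a_m | b_1..b_m (lists a, b of length m with entries in [d])
  from the origin of Z^d with steps e_{a_1},..,e_{a_m},-e_{b_1},..,-e_{b_m}, ending in P
  (P given by its coordinates P k, k in [d]).\<close>
definition W_star :: "nat \<Rightarrow> nat \<Rightarrow> (nat \<Rightarrow> int) \<Rightarrow> (nat list \<times> nat list) set" where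
  "W_star d len P = {(a, b). length a = length b \<and> length a + length b = len \<and>
       set a \<subseteq> {1..d} \<and> set b \<subseteq> {1..d} \<and>
       (\<forall>k\<in>{1..d}. int (count_list a k) - int (count_list b k) = P k)}"

definition T_pt :: "(nat \<Rightarrow> nat) \<Rightarrow> nat \<Rightarrow> int" where
  "T_pt p k = int k - int (p k)"

text \<open>W-hat'(d, 2rn; P): walks in W*(d,2rn;P) with a_{u_i^s} < a_{u_i^{s+1}} and
  b_{v_i^s} < b_{v_i^{s+1}}, where a_{u_i^s} = a_{r(i-1)+s} (lists are 0-indexed, so this
  is a ! (r*(i-1)+s-1)).\<close>
definition W_hat' :: "nat \<Rightarrow> nat \<Rightarrow> nat \<Rightarrow> (nat \<Rightarrow> int) \<Rightarrow> (nat list \<times> nat list) set" where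
  "W_hat' n r d P = {(a, b) \<in> W_star d (2 * (r * n)) P.
       \<forall>i\<in>{1..n}. \<forall>s. 1 \<le> s \<and> s < r \<longrightarrow>
         a ! (r * (i - 1) + s - 1) < a ! (r * (i - 1) + s) \<and>
         b ! (r * (i - 1) + s - 1) < b ! (r * (i - 1) + s)}"

end

theory Submission
  imports Defs
begin

text \<open>
  RSK is used in the form of Fomin's growth diagrams. Put a partition at every point of the grid
  \<open>{0..n} \<times> {0..n}\<close>, empty on the two axes; from the corners \<open>l\<close> (south-west), \<open>u\<close>, \<open>v\<close> of a unit
  square and its matrix entry \<open>m\<close>, the fourth corner \<open>w\<close> is
  \<open>w\<^sub>0 = max u\<^sub>0 v\<^sub>0 + m\<close> and \<open>w\<^sub>x\<^sub>+\<^sub>1 = max u\<^sub>x\<^sub>+\<^sub>1 v\<^sub>x\<^sub>+\<^sub>1 + min u\<^sub>x v\<^sub>x - l\<^sub>x\<close>.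
  This rule is invertible, so matrices correspond to pairs of chains of horizontal strips with a
  common end. Sizes of the partitions are sums of the matrix over rectangles, and the recursion for
  the first row is the one for the largest planar subgraph, so no separate form of Schensted's
  theorem is needed.

  Passing to conjugate partitions, a chain of horizontal strips with at most \<open>d\<close> columns is a
  sequence of \<open>r\<close>-subsets of \<open>{1..d}\<close> (the columns met by each strip) all of whose prefixes have
  weakly decreasing counts. Reading the columns of the entries of a standard tableau turns
  Condition \<open>T\<close>-hat into strict ascents inside the blocks, which gives (i). A pair of such sequences
  with the same counts, the second one reversed, is a walk from \<open>(-1, \<dots>, -d)\<close> to itself
  that never meets a wall \<open>x\<^sub>k = x\<^sub>k\<^sub>+\<^sub>1\<close>. A step changes \<open>x\<^sub>k - x\<^sub>k\<^sub>+\<^sub>1\<close> by at most one, so no wall can be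
  jumped over, and swapping the coordinates \<open>k\<close>, \<open>k + 1\<close> after the first meeting cancels all the other
  walks in the signed sum, which gives (ii).
\<close>

section \<open>Growth diagrams\<close>

text \<open>Partitions are functions giving the row lengths; \<open>interlace l u\<close> says that \<open>u / l\<close> is a
  horizontal strip, and it forces both functions to be weakly decreasing.\<close>
definition interlace :: "(nat \<Rightarrow> nat) \<Rightarrow> (nat \<Rightarrow> nat) \<Rightarrow> bool" where
  "interlace l u \<longleftrightarrow> (\<forall>x. l x \<le> u x \<and> u (Suc x) \<le> l x)"

definition grow :: "nat \<Rightarrow> (nat \<Rightarrow> nat) \<Rightarrow> (nat \<Rightarrow> nat) \<Rightarrow> (nat \<Rightarrow> nat) \<Rightarrow> nat \<Rightarrow> nat" where
  "grow m l u v x = (case x of 0 \<Rightarrow> max (u 0) (v 0) + m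
     | Suc y \<Rightarrow> max (u (Suc y)) (v (Suc y)) + min (u y) (v y) - l y)"

text \<open>The equation for \<open>w (Suc x)\<close> in \<open>grow\<close>, solved for
  \<open>l x\<close>. Row 0 of \<open>w\<close> is left for recovering the matrix entry.\<close>

definition shrink :: "(nat \<Rightarrow> nat) \<Rightarrow> (nat \<Rightarrow> nat) \<Rightarrow> (nat \<Rightarrow> nat) \<Rightarrow> nat \<Rightarrow> nat" where
  "shrink w u v x = max (u (Suc x)) (v (Suc x)) + min (u x) (v x) - w (Suc x)"

lemma grow_0 [simp]: "grow m l u v 0 = max (u 0) (v 0) + m"
  by (simp add: grow_def)

lemma grow_Suc [simp]:
  "grow m l u v (Suc y) = max (u (Suc y)) (v (Suc y)) + min (u y) (v y) - l y"
  by (simp add: grow_def)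

lemma interlace_le: "interlace l u \<Longrightarrow> l x \<le> u x"
  and interlace_Suc_le: "interlace l u \<Longrightarrow> u (Suc x) \<le> l x"
  by (auto simp: interlace_def)

lemma grow_commute: "grow m l u v = grow m l v u"
  by (auto simp: grow_def max.commute min.commute split: nat.split)

lemma shrink_commute: "shrink w u v = shrink w v u"
  by (auto simp: shrink_def max.commute min.commute)

text \<open>The value \<open>l x\<close> lies between \<open>max (u (Suc x)) (v (Suc x))\<close> and
  \<open>min (u x) (v x)\<close>. The rule reflects it in this interval, so row \<open>Suc x\<close>
  of the new corner lies there too and no subtraction is truncated.\<close>

lemma interlace_grow:
  assumes "interlace l u" "interlace l v"
  shows "interlace u (grow m l u v)" "interlace v (grow m l u v)"
proof -
  have *: "interlace u (grow m l u v)" if "interlace l u" "interlace l v" for u v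
    unfolding interlace_def
  proof
    fix x
    have "u x \<le> grow m l u v x"
    proof (cases x)
      case (Suc y)
      then show ?thesis using interlace_le[OF that(1), of y] interlace_le[OF that(2), of y]
        by auto
    qed auto
    moreover have "grow m l u v (Suc x) \<le> u x"
      using interlace_Suc_le[OF that(1), of x] interlace_Suc_le[OF that(2), of x] by auto
    ultimately show "u x \<le> grow m l u v x \<and> grow m l u v (Suc x) \<le> u x" ..
  qed
  show "interlace u (grow m l u v)" "interlace v (grow m l u v)"
    using *[of u v] *[of v u] assms by (auto simp: grow_commute)
qed

text \<open>The same reflection read backwards: \<open>w (Suc x)\<close> lies in the interval, hence
  so does the value of \<open>shrink\<close> at \<open>x\<close>.\<close>

lemma interlace_shrink:
  assumes "interlace u w" "interlace v w"
  shows "interlace (shrink w u v) u" "interlace (shrink w u v) v"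
proof -
  have *: "interlace (shrink w u v) u" if "interlace u w" "interlace v w" for u v
    unfolding interlace_def shrink_def
  proof
    fix x
    show "max (u (Suc x)) (v (Suc x)) + min (u x) (v x) - w (Suc x) \<le> u x \<and>
          u (Suc x) \<le> max (u (Suc x)) (v (Suc x)) + min (u x) (v x) - w (Suc x)"
      using interlace_le[OF that(1), of "Suc x"] interlace_le[OF that(2), of "Suc x"]
        interlace_Suc_le[OF that(1), of x] interlace_Suc_le[OF that(2), of x] by auto
  qed
  show "interlace (shrink w u v) u" "interlace (shrink w u v) v"
    using *[of u v] *[of v u] assms by (auto simp: shrink_commute)
qed

lemma shrink_grow:
  assumes "interlace l u" "interlace l v"
  shows "shrink (grow m l u v) u v = l"
proof
  fix x
  show "shrink (grow m l u v) u v x = l x"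
    using interlace_le[OF assms(1), of x] interlace_le[OF assms(2), of x]
    by (simp add: shrink_def)
qed

lemma grow_shrink:
  assumes "interlace u w" "interlace v w"
  shows "grow (w 0 - max (u 0) (v 0)) (shrink w u v) u v = w"
proof
  fix x
  show "grow (w 0 - max (u 0) (v 0)) (shrink w u v) u v x = w x"
  proof (cases x)
    case 0
    then show ?thesis
      using interlace_le[OF assms(1), of 0] interlace_le[OF assms(2), of 0] by auto
  next
    case (Suc y)
    then show ?thesis
      using interlace_Suc_le[OF assms(1), of y] interlace_Suc_le[OF assms(2), of y]
      by (auto simp: shrink_def)
  qed
qed

section \<open>Growth diagram of a matrix\<close>

fun growth :: "(nat \<Rightarrow> nat \<Rightarrow> nat) \<Rightarrow> nat \<Rightarrow> nat \<Rightarrow> nat \<Rightarrow> nat" where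
  "growth M 0 j = (\<lambda>_. 0)"
| "growth M (Suc i) 0 = (\<lambda>_. 0)"
| "growth M (Suc i) (Suc j) =
     grow (M (Suc i) (Suc j)) (growth M i j) (growth M (Suc i) j) (growth M i (Suc j))"

lemma growth_0_right [simp]: "growth M i 0 = (\<lambda>_. 0)"
  by (cases i) auto

text \<open>Both inclusions are proved together by induction on \<open>i + j\<close>, because the
  rule at a unit square needs both of them at its south-west corner.\<close>

lemma interlace_growth:
  "interlace (growth M i j) (growth M i (Suc j)) \<and> interlace (growth M i j) (growth M (Suc i) j)"
proof (induction "i + j" arbitrary: i j rule: less_induct)
  case less
  have 1: "interlace (growth M i j) (growth M i (Suc j))"
  proof (cases i)
    case (Suc i')
    then show ?thesis using less[of i' j] interlace_grow(1) by auto
  qed (simp add: interlace_def)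
  have 2: "interlace (growth M i j) (growth M (Suc i) j)"
  proof (cases j)
    case (Suc j')
    then show ?thesis using less[of i j'] interlace_grow(2) by auto
  qed (simp add: interlace_def)
  from 1 2 show ?case ..
qed

text \<open>Each increase of \<open>i\<close> adds a horizontal strip, hence at most one new row. So
  sums over \<open>x \<le> N\<close> with \<open>i \<le> N\<close> give the whole size of the
  partition.\<close>

lemma growth_eq_0: "i \<le> x \<Longrightarrow> growth M i j x = 0"
proof (induction i arbitrary: x)
  case (Suc i)
  then obtain y where y: "x = Suc y" "i \<le> y" by (cases x) auto
  have "growth M (Suc i) j (Suc y) \<le> growth M i j y"
    using interlace_growth interlace_Suc_le by blast
  then show ?case using Suc.IH[of y] y by auto
qed auto

definition rect_sum :: "(nat \<Rightarrow> nat \<Rightarrow> nat) \<Rightarrow> nat \<Rightarrow> nat \<Rightarrow> nat" where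
  "rect_sum S i j = (\<Sum>a=1..i. \<Sum>b=1..j. S a b)"

lemma rect_sum_0 [simp]: "rect_sum S 0 j = 0" "rect_sum S i 0 = 0"
  by (simp_all add: rect_sum_def)

lemma rect_sum_Suc_left: "rect_sum S (Suc i) j = rect_sum S i j + (\<Sum>b=1..j. S (Suc i) b)"
  by (simp add: rect_sum_def)

lemma rect_sum_Suc_right: "rect_sum S i (Suc j) = rect_sum S i j + (\<Sum>a=1..i. S a (Suc j))"
  by (simp add: rect_sum_def sum.distrib)

text \<open>Local conservation of size, from \<open>max a b + min a b = a + b\<close>. As row
  \<open>N\<close> of \<open>u\<close> and \<open>v\<close> is empty, the shifted sums lose nothing
  at the cut-off.\<close>

lemma sum_grow:
  assumes "interlace l u" "interlace l v" "u N = 0" "v N = 0"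
  shows "(\<Sum>x\<le>N. grow m l u v x) + (\<Sum>x\<le>N. l x) = m + (\<Sum>x\<le>N. u x) + (\<Sum>x\<le>N. v x)"
proof -
  have l: "l N = 0" using interlace_le[OF assms(1), of N] assms(3) by simp
  have "(\<Sum>x\<le>N. grow m l u v x) = grow m l u v 0 + (\<Sum>x<N. grow m l u v (Suc x))"
    by (rule sum.atMost_shift)
  moreover have "(\<Sum>x\<le>N. l x) = (\<Sum>x<N. l x)"
    using l by (simp add: lessThan_Suc_atMost[symmetric])
  moreover have "(\<Sum>x<N. grow m l u v (Suc x)) + (\<Sum>x<N. l x) =
      (\<Sum>x<N. max (u (Suc x)) (v (Suc x))) + (\<Sum>x<N. min (u x) (v x))"
    unfolding sum.distrib[symmetric]
  proof (rule sum.cong)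
    fix x
    show "grow m l u v (Suc x) + l x = max (u (Suc x)) (v (Suc x)) + min (u x) (v x)"
      using interlace_le[OF assms(1), of x] interlace_le[OF assms(2), of x] by auto
  qed simp
  moreover have "max (u 0) (v 0) + (\<Sum>x<N. max (u (Suc x)) (v (Suc x))) = (\<Sum>x\<le>N. max (u x) (v x))"
    by (rule sum.atMost_shift[symmetric])
  moreover have "(\<Sum>x<N. min (u x) (v x)) = (\<Sum>x\<le>N. min (u x) (v x))"
    using assms by (simp add: lessThan_Suc_atMost[symmetric])
  moreover have "(\<Sum>x\<le>N. max (u x) (v x)) + (\<Sum>x\<le>N. min (u x) (v x)) = (\<Sum>x\<le>N. u x) + (\<Sum>x\<le>N. v x)"
    unfolding sum.distrib[symmetric] by (rule sum.cong) auto
  ultimately show ?thesis by simp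
qed

lemma sum_growth:
  assumes "i \<le> N"
  shows "(\<Sum>x\<le>N. growth M i j x) = rect_sum M i j"
  using assms
proof (induction M i j rule: growth.induct)
  case (3 M i j)
  have "(\<Sum>x\<le>N. growth M (Suc i) (Suc j) x) + (\<Sum>x\<le>N. growth M i j x) =
      M (Suc i) (Suc j) + (\<Sum>x\<le>N. growth M (Suc i) j x) + (\<Sum>x\<le>N. growth M i (Suc j) x)"
    unfolding growth.simps
    by (rule sum_grow) (use 3 interlace_growth in \<open>auto simp: growth_eq_0\<close>)
  then show ?case using 3 by (simp add: rect_sum_Suc_left rect_sum_Suc_right)
qed auto

section \<open>First rows and largest planar subgraphs\<close>

text \<open>An edge of the last row and an edge of the last column, both away from the common
  corner, would cross. So a planar subgraph can drop the last row or the last column at the cost of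
  the corner multiplicity alone, as in the recursion for row 0.\<close>

lemma rect_sum_planar_le_growth:
  assumes "planar_subgraph M S"
  shows "rect_sum S i j \<le> growth M i j 0"
  using assms
proof (induction M i j rule: growth.induct)
  case (3 M i j)
  have "S (Suc i) (Suc j) \<le> M (Suc i) (Suc j)"
    using 3 by (simp add: planar_subgraph_def)
  moreover have "(\<forall>b\<in>{1..j}. S (Suc i) b = 0) \<or> (\<forall>a\<in>{1..i}. S a (Suc j) = 0)"
  proof (rule ccontr)
    assume "\<not> ?thesis"
    then obtain a b where ab: "b \<in> {1..j}" "0 < S (Suc i) b" "a \<in> {1..i}" "0 < S a (Suc j)"
      by auto
    then have "(Suc i \<le> a \<and> b \<le> Suc j) \<or> (a \<le> Suc i \<and> Suc j \<le> b)"
      using 3 unfolding planar_subgraph_def by blast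
    with ab show False by auto
  qed
  then have "rect_sum S (Suc i) (Suc j) = rect_sum S i (Suc j) + S (Suc i) (Suc j) \<or>
    rect_sum S (Suc i) (Suc j) = rect_sum S (Suc i) j + S (Suc i) (Suc j)"
  proof
    assume "\<forall>b\<in>{1..j}. S (Suc i) b = 0"
    then show ?thesis using rect_sum_Suc_left[of S i "Suc j"] by simp
  next
    assume "\<forall>a\<in>{1..i}. S a (Suc j) = 0"
    then show ?thesis using rect_sum_Suc_right[of S "Suc i" j] by simp
  qed
  ultimately show ?case using 3 by auto
qed auto

lemma rect_sum_add:
  "rect_sum (\<lambda>a b. S a b + T a b) i j = rect_sum S i j + rect_sum T i j"
  by (simp add: rect_sum_def sum.distrib)

lemma rect_sum_single:
  assumes "1 \<le> i" "1 \<le> j"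
  shows "rect_sum (\<lambda>a b. if a = i \<and> b = j then m else 0) i j = m"
proof -
  have "rect_sum (\<lambda>a b. if a = i \<and> b = j then m else 0) i j =
      (\<Sum>a=1..i. if a = i then m else 0)"
    unfolding rect_sum_def using assms by (intro sum.cong) auto
  then show ?thesis using assms by simp
qed

lemma rect_sum_eq:
  assumes "\<forall>a b. S a b \<noteq> 0 \<longrightarrow> a \<in> {1..i} \<and> b \<in> {1..j}" "i \<le> i'" "j \<le> j'"
  shows "rect_sum S i' j' = rect_sum S i j"
proof -
  have "sum (case_prod S) ({1..i} \<times> {1..j}) = sum (case_prod S) ({1..i'} \<times> {1..j'})"
    by (rule sum.mono_neutral_left) (use assms in \<open>fastforce+\<close>)
  then show ?thesis by (simp add: rect_sum_def sum.cartesian_product)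
qed

text \<open>Take an optimal subgraph of the better of the two smaller rectangles and add all copies
  of the corner edge, which crosses no edge of the rectangle.\<close>

lemma planar_subgraph_exists:
  "\<exists>S. planar_subgraph M S \<and> (\<forall>a b. S a b \<noteq> 0 \<longrightarrow> a \<in> {1..i} \<and> b \<in> {1..j}) \<and>
       rect_sum S i j = growth M i j 0"
proof (induction M i j rule: growth.induct)
  case (3 M i j)
  \<comment> \<open>\<open>i'\<close> and \<open>j'\<close> describe the chosen rectangle. By
    \<open>out\<close> it misses the corner, so adding the corner edges does not exceed their
    multiplicity.\<close>
  obtain i' j' S where ij: "i' \<le> Suc i" "j' \<le> Suc j" and S: "planar_subgraph M S"
    "\<forall>a b. S a b \<noteq> 0 \<longrightarrow> a \<in> {1..i'} \<and> b \<in> {1..j'}" and out: "i' \<le> i \<or> j' \<le> j" and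
    sum: "rect_sum S i' j' = max (growth M (Suc i) j 0) (growth M i (Suc j) 0)"
  proof (cases "growth M (Suc i) j 0 \<le> growth M i (Suc j) 0")
    case True
    then show ?thesis using 3(3) that[of i "Suc j"] by (auto simp: max_def)
  next
    case False
    then show ?thesis using 3(2) that[of "Suc i" j] by (auto simp: max_def)
  qed
  define S' where "S' = (\<lambda>a b. S a b + (if a = Suc i \<and> b = Suc j then M a b else 0))"
  have S0: "S (Suc i) (Suc j) = 0"
  proof (rule ccontr)
    assume "S (Suc i) (Suc j) \<noteq> 0"
    with S(2) have "Suc i \<in> {1..i'} \<and> Suc j \<in> {1..j'}" by blast
    with out show False by auto
  qed
  have bnd: "a \<le> Suc i" "b \<le> Suc j" "1 \<le> a" "1 \<le> b" if "S a b \<noteq> 0" for a b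
  proof -
    have "a \<in> {1..i'} \<and> b \<in> {1..j'}" using S(2) that by blast
    with ij show "a \<le> Suc i" "b \<le> Suc j" "1 \<le> a" "1 \<le> b" by auto
  qed
  have "planar_subgraph M S'"
    unfolding planar_subgraph_def
  proof (intro conjI allI impI)
    fix a b
    show "S' a b \<le> M a b" using S(1) S0 by (auto simp: S'_def planar_subgraph_def)
  next
    fix a b a' b'
    assume "0 < S' a b \<and> 0 < S' a' b'"
    then have "S a b \<noteq> 0 \<or> a = Suc i \<and> b = Suc j" "S a' b' \<noteq> 0 \<or> a' = Suc i \<and> b' = Suc j"
      by (auto simp: S'_def split: if_splits)
    then show "a \<le> a' \<and> b \<le> b' \<or> a' \<le> a \<and> b' \<le> b"
    proof (elim disjE)
      assume "S a b \<noteq> 0" "S a' b' \<noteq> 0"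
      then show ?thesis using S(1) unfolding planar_subgraph_def by blast
    qed (use bnd in auto)
  qed
  moreover have "\<forall>a b. S' a b \<noteq> 0 \<longrightarrow> a \<in> {1..Suc i} \<and> b \<in> {1..Suc j}"
    using bnd by (auto simp: S'_def split: if_splits)
  moreover have "rect_sum S' (Suc i) (Suc j) = growth M (Suc i) (Suc j) 0"
  proof -
    have "rect_sum S' (Suc i) (Suc j) = rect_sum S (Suc i) (Suc j) +
        rect_sum (\<lambda>a b. if a = Suc i \<and> b = Suc j then M (Suc i) (Suc j) else 0) (Suc i) (Suc j)"
      unfolding rect_sum_add[symmetric] by (rule arg_cong[of _ _ "\<lambda>S. rect_sum S _ _"])
        (auto simp: S'_def fun_eq_iff)
    also have "\<dots> = rect_sum S (Suc i) (Suc j) + M (Suc i) (Suc j)"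
      by (subst rect_sum_single) auto
    also have "rect_sum S (Suc i) (Suc j) = rect_sum S i' j'"
      by (rule rect_sum_eq) (use S ij in auto)
    finally show ?thesis using sum by simp
  qed
  ultimately show ?case by blast
qed (auto intro!: exI[of _ "\<lambda>_ _. 0"] simp: planar_subgraph_def)

lemma planar_le_iff_growth:
  "(\<forall>S. planar_subgraph M S \<longrightarrow> num_edges n S \<le> d) \<longleftrightarrow> growth M n n 0 \<le> d"
proof -
  have "num_edges n S = rect_sum S n n" for S
    by (simp add: num_edges_def rect_sum_def)
  then show ?thesis
    using rect_sum_planar_le_growth planar_subgraph_exists[of M n n] by (metis order_trans)
qed

section \<open>Regular matrices and pairs of chains of horizontal strips\<close>

text \<open>Sums up to \<open>n\<close> are full sizes, since the partition at index
  \<open>i\<close> has at most \<open>i\<close> rows. The value zero beyond \<open>n\<close> makes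
  each chain a single function, so that \<open>card\<close> counts chains.\<close>

definition strip_chain :: "nat \<Rightarrow> nat \<Rightarrow> (nat \<Rightarrow> nat \<Rightarrow> nat) \<Rightarrow> bool" where
  "strip_chain n r P \<longleftrightarrow> P 0 = (\<lambda>_. 0) \<and> (\<forall>i<n. interlace (P i) (P (Suc i))) \<and>
     (\<forall>i\<le>n. (\<Sum>x\<le>n. P i x) = r * i) \<and> (\<forall>i>n. P i = (\<lambda>_. 0))"

definition growth_boundary ::
  "nat \<Rightarrow> (nat \<Rightarrow> nat \<Rightarrow> nat) \<Rightarrow> (nat \<Rightarrow> nat \<Rightarrow> nat) \<times> (nat \<Rightarrow> nat \<Rightarrow> nat)" where
  "growth_boundary n M = (\<lambda>j. if j \<le> n then growth M n j else (\<lambda>_. 0),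
                          \<lambda>i. if i \<le> n then growth M i n else (\<lambda>_. 0))"

lemma rect_sum_regular:
  assumes "reg_bip_multigraph n r M" "i \<le> n"
  shows "rect_sum M i n = r * i" "rect_sum M n i = r * i"
proof -
  have "rect_sum M i n = (\<Sum>a=1..i. r)"
    unfolding rect_sum_def using assms by (intro sum.cong) (auto simp: reg_bip_multigraph_def)
  then show "rect_sum M i n = r * i" by simp
  have "rect_sum M n i = (\<Sum>b=1..i. \<Sum>a=1..n. M a b)"
    unfolding rect_sum_def by (rule sum.swap)
  also have "\<dots> = (\<Sum>b=1..i. r)"
    using assms by (intro sum.cong) (auto simp: reg_bip_multigraph_def)
  finally show "rect_sum M n i = r * i" by simp
qed

lemma strip_chain_growth_boundary:
  assumes "reg_bip_multigraph n r M" "growth_boundary n M = (P, Q)"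
  shows "strip_chain n r P" "strip_chain n r Q"
proof -
  have PQ: "P = (\<lambda>j. if j \<le> n then growth M n j else (\<lambda>_. 0))"
    "Q = (\<lambda>i. if i \<le> n then growth M i n else (\<lambda>_. 0))"
    using assms(2) by (simp_all add: growth_boundary_def)
  show "strip_chain n r P" "strip_chain n r Q"
    unfolding strip_chain_def PQ using assms(1) interlace_growth
    by (auto simp: sum_growth rect_sum_regular simp del: growth.simps(3))
qed

text \<open>Induction from the corner \<open>(n, n)\<close> towards the axes: \<open>shrink\<close>
  computes each corner from three that are closer to \<open>(n, n)\<close>.\<close>

lemma growth_boundary_determines:
  assumes "\<forall>j\<le>n. growth M n j = growth M' n j" "\<forall>i\<le>n. growth M i n = growth M' i n"
    and "i \<le> n" "j \<le> n"
  shows "growth M i j = growth M' i j"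
  using assms(3,4)
proof (induction "n - i + (n - j)" arbitrary: i j rule: less_induct)
  case less
  show ?case
  proof (cases "i = n \<or> j = n")
    case True
    then show ?thesis using less.prems assms by auto
  next
    case False
    then have lt: "i < n" "j < n" using less.prems by auto
    have eq: "growth M i j = shrink (growth M (Suc i) (Suc j)) (growth M (Suc i) j) (growth M i (Suc j))"
      for M using interlace_growth by (simp add: shrink_grow)
    have "growth M (Suc i) (Suc j) = growth M' (Suc i) (Suc j)"
      "growth M (Suc i) j = growth M' (Suc i) j" "growth M i (Suc j) = growth M' i (Suc j)"
      by (rule less.hyps; use lt in simp)+
    then show ?thesis by (subst (1 2) eq) simp
  qed
qed

lemma inj_on_growth_boundary:
  "inj_on (growth_boundary n) {M. reg_bip_multigraph n r M}"
proof (rule inj_onI, clarify)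
  fix M M'
  assume reg: "reg_bip_multigraph n r M" "reg_bip_multigraph n r M'"
    and eq: "growth_boundary n M = growth_boundary n M'"
  have "growth M n j = growth M' n j" "growth M j n = growth M' j n" if "j \<le> n" for j
    using eq that unfolding growth_boundary_def by (auto dest: fun_cong[where x = j])
  then have *: "growth M i j = growth M' i j" if "i \<le> n" "j \<le> n" for i j
    using growth_boundary_determines that by blast
  show "M = M'"
  proof (intro ext)
    fix i j
    show "M i j = M' i j"
    proof (cases "i \<in> {1..n} \<and> j \<in> {1..n}")
      case True
      then obtain i' j' where ij: "i = Suc i'" "j = Suc j'"
        by (metis Suc_le_D atLeastAtMost_iff One_nat_def)
      \<comment> \<open>Row 0 of the rule gives the entry as a difference of first rows already
        known to agree.\<close>
      have "growth M i j 0 = growth M' i j 0" "growth M i j' 0 = growth M' i j' 0"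
        "growth M i' j 0 = growth M' i' j 0"
        using *[of i j] *[of i j'] *[of i' j] True ij by simp_all
      then show ?thesis using ij by (simp del: One_nat_def)
    next
      case False
      then show ?thesis using reg unfolding reg_bip_multigraph_def by metis
    qed
  qed
qed

text \<open>Indices run backwards from the corner \<open>(n, n)\<close>: position \<open>(a, b)\<close> is the point \<open>(n - a, n - b)\<close>
  of the growth diagram.\<close>
fun shrink_grid :: "(nat \<Rightarrow> nat \<Rightarrow> nat) \<Rightarrow> (nat \<Rightarrow> nat \<Rightarrow> nat) \<Rightarrow> nat \<Rightarrow> nat \<Rightarrow> nat \<Rightarrow> nat \<Rightarrow> nat" where
  "shrink_grid P Q n 0 b = P (n - b)"
| "shrink_grid P Q n (Suc a) 0 = Q (n - Suc a)"
| "shrink_grid P Q n (Suc a) (Suc b) =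
     shrink (shrink_grid P Q n a b) (shrink_grid P Q n a (Suc b)) (shrink_grid P Q n (Suc a) b)"

context
  fixes P Q :: "nat \<Rightarrow> nat \<Rightarrow> nat" and n r :: nat
  assumes P: "strip_chain n r P" and Q: "strip_chain n r Q" and PQ: "P n = Q n"
begin

lemma interlace_shrink_grid:
  "(a \<le> n \<longrightarrow> b < n \<longrightarrow>
      interlace (shrink_grid P Q n a (Suc b)) (shrink_grid P Q n a b)) \<and>
   (a < n \<longrightarrow> b \<le> n \<longrightarrow>
      interlace (shrink_grid P Q n (Suc a) b) (shrink_grid P Q n a b))"
proof (induction "a + b" arbitrary: a b rule: less_induct)
  case less
  have 1: "interlace (shrink_grid P Q n a (Suc b)) (shrink_grid P Q n a b)" if "a \<le> n" "b < n"
  proof (cases a)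
    case 0
    then have "interlace (P (n - Suc b)) (P (Suc (n - Suc b)))"
      using P that by (auto simp: strip_chain_def)
    then show ?thesis using 0 that by (simp add: Suc_diff_Suc)
  next
    case (Suc a')
    then show ?thesis using less[of a' b] that interlace_shrink(2) by auto
  qed
  have 2: "interlace (shrink_grid P Q n (Suc a) b) (shrink_grid P Q n a b)" if "a < n" "b \<le> n"
  proof (cases b)
    case 0
    then have "interlace (Q (n - Suc a)) (Q (Suc (n - Suc a)))"
      using Q that by (auto simp: strip_chain_def)
    \<comment> \<open>At the corner the grid takes its value from \<open>P\<close>, so the last
      strip of \<open>Q\<close> meets it through \<open>P n = Q n\<close>.\<close>
    then show ?thesis using 0 that PQ by (cases a) (simp_all add: Suc_diff_Suc)
  next
    case (Suc b')
    then show ?thesis using less[of a b'] that interlace_shrink(1) by auto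
  qed
  from 1 2 show ?case by blast
qed

text \<open>Position \<open>n\<close> is an axis. Along it the partitions can only shrink, starting
  from the empty \<open>P 0\<close> or \<open>Q 0\<close>.\<close>

lemma shrink_grid_corner_zero:
  assumes "a \<le> n"
  shows "shrink_grid P Q n a n = (\<lambda>_. 0)" "shrink_grid P Q n n a = (\<lambda>_. 0)"
proof -
  show "shrink_grid P Q n a n = (\<lambda>_. 0)"
    using assms
  proof (induction a)
    case 0
    then show ?case using P by (simp add: strip_chain_def)
  next
    case (Suc a)
    then have "interlace (shrink_grid P Q n (Suc a) n) (shrink_grid P Q n a n)"
      using interlace_shrink_grid[of a n] by simp
    then have "shrink_grid P Q n (Suc a) n x \<le> 0" for x
      using interlace_le[of "shrink_grid P Q n (Suc a) n" _ x] Suc by fastforce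
    then show ?case by auto
  qed
  show "shrink_grid P Q n n a = (\<lambda>_. 0)"
    using assms
  proof (induction a)
    case 0
    then show ?case using P Q by (cases n) (simp_all add: strip_chain_def)
  next
    case (Suc a)
    then have "interlace (shrink_grid P Q n n (Suc a)) (shrink_grid P Q n n a)"
      using interlace_shrink_grid[of n a] by simp
    then have "shrink_grid P Q n n (Suc a) x \<le> 0" for x
      using interlace_le[of "shrink_grid P Q n n (Suc a)" _ x] Suc by fastforce
    then show ?case by auto
  qed
qed

text \<open>The entries are read off row 0 by the inverse rule, and \<open>grow_shrink\<close> makes
  the growth diagram of \<open>M\<close> retrace the grid. Regularity comes from sizes: consecutive
  partitions of a chain differ by \<open>r\<close> cells, and these differences are the row and
  column sums.\<close>

lemma growth_boundary_surj:
  "\<exists>M. reg_bip_multigraph n r M \<and> growth_boundary n M = (P, Q)"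
proof -
  define K where "K = shrink_grid P Q n"
  define M where "M = (\<lambda>i j. if i \<in> {1..n} \<and> j \<in> {1..n}
    then K (n - i) (n - j) 0 - max (K (n - i) (Suc (n - j)) 0) (K (Suc (n - i)) (n - j) 0) else 0)"
  have gr: "growth M i j = K (n - i) (n - j)" if "i \<le> n" "j \<le> n" for i j
    using that
  proof (induction "i + j" arbitrary: i j rule: less_induct)
    case less
    show ?case
    proof (cases "i = 0 \<or> j = 0")
      case True
      then show ?thesis using less.prems by (auto simp: K_def shrink_grid_corner_zero)
    next
      case False
      then obtain i' j' where ij: "i = Suc i'" "j = Suc j'" by (metis not0_implies_Suc)
      have s: "n - i' = Suc (n - i)" "n - j' = Suc (n - j)" using ij less.prems by auto
      have "growth M i j = grow (M i j) (K (Suc (n - i)) (Suc (n - j)))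
          (K (n - i) (Suc (n - j))) (K (Suc (n - i)) (n - j))"
        using less.hyps[of i' j'] less.hyps[of i j'] less.hyps[of i' j] less.prems ij s by simp
      also have "K (Suc (n - i)) (Suc (n - j)) =
          shrink (K (n - i) (n - j)) (K (n - i) (Suc (n - j))) (K (Suc (n - i)) (n - j))"
        by (simp add: K_def)
      also have "M i j = K (n - i) (n - j) 0 -
          max (K (n - i) (Suc (n - j)) 0) (K (Suc (n - i)) (n - j) 0)"
        using ij less.prems by (simp add: M_def)
      also have "grow \<dots> (shrink (K (n - i) (n - j)) (K (n - i) (Suc (n - j))) (K (Suc (n - i)) (n - j)))
          (K (n - i) (Suc (n - j))) (K (Suc (n - i)) (n - j)) = K (n - i) (n - j)"
        unfolding K_def
        by (rule grow_shrink) (use interlace_shrink_grid[of "n - i" "n - j"] ij less.prems in auto)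
      finally show ?thesis .
    qed
  qed
  have bd: "growth M n j = P j" "growth M j n = Q j" if "j \<le> n" for j
  proof -
    show "growth M n j = P j" using gr[of n j] that by (simp add: K_def)
    show "growth M j n = Q j"
    proof (cases "n - j")
      case (Suc a)
      then have "n - Suc a = j" using that by simp
      then show ?thesis using gr[of j n] that Suc by (simp add: K_def)
    qed (use gr[of j n] that PQ in \<open>auto simp: K_def\<close>)
  qed
  have R: "rect_sum M n j = r * j" "rect_sum M j n = r * j" if "j \<le> n" for j
    using sum_growth[of n n M j] sum_growth[of j n M n] bd that P Q
    by (simp_all add: strip_chain_def)
  have "reg_bip_multigraph n r M"
    unfolding reg_bip_multigraph_def
  proof (intro conjI ballI)
    show "\<forall>i j. M i j \<noteq> 0 \<longrightarrow> i \<in> {1..n} \<and> j \<in> {1..n}" by (simp add: M_def)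
  next
    fix i assume "i \<in> {1..n}"
    then obtain i' where "i = Suc i'" "i \<le> n" by (cases i) auto
    then show "(\<Sum>j=1..n. M i j) = r"
      using R(2)[of i] R(2)[of i'] rect_sum_Suc_left[of M i' n] by simp
  next
    fix j assume "j \<in> {1..n}"
    then obtain j' where "j = Suc j'" "j \<le> n" by (cases j) auto
    then show "(\<Sum>i=1..n. M i j) = r"
      using R(1)[of j] R(1)[of j'] rect_sum_Suc_right[of M n j'] by simp
  qed
  moreover have "growth_boundary n M = (P, Q)"
    using bd P Q by (auto simp: growth_boundary_def strip_chain_def fun_eq_iff)
  ultimately show ?thesis by blast
qed

end

lemma bij_betw_growth_boundary:
  "bij_betw (growth_boundary n) {M. reg_bip_multigraph n r M \<and> growth M n n 0 \<le> d}
     {(P, Q). strip_chain n r P \<and> strip_chain n r Q \<and> P n = Q n \<and> P n 0 \<le> d}"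
  unfolding bij_betw_def
proof (intro conjI subset_antisym subsetI)
  show "inj_on (growth_boundary n) {M. reg_bip_multigraph n r M \<and> growth M n n 0 \<le> d}"
    by (rule inj_on_subset[OF inj_on_growth_boundary]) auto
next
  fix z assume "z \<in> growth_boundary n ` {M. reg_bip_multigraph n r M \<and> growth M n n 0 \<le> d}"
  then obtain M P Q where "reg_bip_multigraph n r M" "growth M n n 0 \<le> d"
    "growth_boundary n M = (P, Q)" "z = (P, Q)" by (auto simp: growth_boundary_def)
  then show "z \<in> {(P, Q). strip_chain n r P \<and> strip_chain n r Q \<and> P n = Q n \<and> P n 0 \<le> d}"
    using strip_chain_growth_boundary by (auto simp: growth_boundary_def)
next
  fix z assume "z \<in> {(P, Q). strip_chain n r P \<and> strip_chain n r Q \<and> P n = Q n \<and> P n 0 \<le> d}"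
  then obtain P Q where z: "z = (P, Q)" "strip_chain n r P" "strip_chain n r Q" "P n = Q n" "P n 0 \<le> d"
    by auto
  then obtain M where M: "reg_bip_multigraph n r M" "growth_boundary n M = z"
    using growth_boundary_surj by blast
  then have "growth M n n 0 \<le> d" using z by (auto simp: growth_boundary_def)
  with M show "z \<in> growth_boundary n ` {M. reg_bip_multigraph n r M \<and> growth M n n 0 \<le> d}"
    by blast
qed

section \<open>Conjugation: chains of horizontal strips as sequences of column sets\<close>

definition set_seqs :: "nat \<Rightarrow> nat \<Rightarrow> nat \<Rightarrow> (nat \<Rightarrow> nat set) set" where
  "set_seqs N r d = {C. (\<forall>t<N. C t \<subseteq> {1..d} \<and> card (C t) = r) \<and> (\<forall>t\<ge>N. C t = {})}"

definition occ :: "(nat \<Rightarrow> nat set) \<Rightarrow> nat \<Rightarrow> nat \<Rightarrow> nat" where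
  "occ C t k = card {s. s < t \<and> k \<in> C s}"

text \<open>\<open>occ A t k\<close> is the length of column \<open>k\<close> after \<open>t\<close>
  strips, so every prefix is required to give the column lengths of a partition.\<close>

definition lattice_seqs :: "nat \<Rightarrow> nat \<Rightarrow> nat \<Rightarrow> (nat \<Rightarrow> nat set) set" where
  "lattice_seqs n r d =
     {A \<in> set_seqs n r d. \<forall>t\<le>n. \<forall>k\<ge>1. occ A t (Suc k) \<le> occ A t k}"

lemma occ_0 [simp]: "occ C 0 k = 0"
  by (simp add: occ_def)

lemma occ_Suc [simp]: "occ C (Suc t) k = occ C t k + (if k \<in> C t then 1 else 0)"
proof -
  have "{s. s < Suc t \<and> k \<in> C s} = {s. s < t \<and> k \<in> C s} \<union> (if k \<in> C t then {t} else {})"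
    by (auto simp: less_Suc_eq)
  then show ?thesis by (auto simp: occ_def)
qed

lemma occ_le: "occ C t k \<le> t"
  by (induction t) auto

lemma occ_mono: "s \<le> t \<Longrightarrow> occ C s k \<le> occ C t k"
  by (rule lift_Suc_mono_le[of "\<lambda>t. occ C t k"]) auto

lemma occ_eq_0: "(\<And>s. s < t \<Longrightarrow> k \<notin> C s) \<Longrightarrow> occ C t k = 0"
  by (induction t) auto

lemma sum_occ:
  assumes "\<And>s. s < t \<Longrightarrow> C s \<subseteq> {1..d}"
  shows "(\<Sum>k\<in>{1..d}. occ C t k) = (\<Sum>s<t. card (C s))"
  using assms
proof (induction t)
  case (Suc t)
  have "(\<Sum>k\<in>{1..d}. if k \<in> C t then 1 else 0 :: nat) = card ({1..d} \<inter> C t)"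
    by (simp add: sum.If_cases)
  also have "{1..d} \<inter> C t = C t" using Suc.prems[of t] by auto
  finally show ?case using Suc by (simp add: sum.distrib)
qed simp

text \<open>Turns the cardinality in a conjugate partition into an order condition: being below the
  cardinality is the same as being a member.\<close>

lemma finite_downset_eq_lessThan:
  fixes X :: "nat set"
  assumes "finite X" "\<And>x y. x \<in> X \<Longrightarrow> y < x \<Longrightarrow> y \<in> X"
  shows "X = {..<card X}"
proof (cases "X = {}")
  case False
  then have "X = {..Max X}"
    using assms(1) assms(2)[OF Max_in[OF assms(1) False]] Max_in[OF assms(1) False] Max_ge[OF assms(1)]
    by (metis (full_types) atMost_iff le_less set_eqI)
  then show ?thesis by (metis card_lessThan lessThan_Suc_atMost)
qed auto

text \<open>Counts the cells of a diagram by rows and by columns. The bounds ensure that neither sum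
  misses a cell.\<close>

lemma sum_conjugate:
  fixes f h :: "nat \<Rightarrow> nat"
  assumes "\<And>x c. c < f x \<longleftrightarrow> x < h c" "\<And>c. h c \<le> N" "\<And>x. f x \<le> d"
  shows "(\<Sum>x\<le>N. f x) = (\<Sum>c<d. h c)"
proof -
  have "(\<Sum>x\<le>N. f x) = card (SIGMA x:{..N}. {..<f x})" by simp
  also have "\<dots> = card (SIGMA c:{..<d}. {..<h c})"
  proof (rule bij_betw_same_card[of prod.swap], rule bij_betw_imageI)
    show "prod.swap ` (SIGMA x:{..N}. {..<f x}) = (SIGMA c:{..<d}. {..<h c})"
    proof (intro subset_antisym subsetI)
      fix z assume "z \<in> prod.swap ` (SIGMA x:{..N}. {..<f x})"
      then show "z \<in> (SIGMA c:{..<d}. {..<h c})"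
        using assms(1) less_le_trans[OF _ assms(3)] by auto
    next
      fix z assume "z \<in> (SIGMA c:{..<d}. {..<h c})"
      then obtain c x where z: "z = (c, x)" "x < h c" by auto
      then have "x \<le> N" "c < f x" using assms(1) less_le_trans[OF z(2) assms(2)] by auto
      then show "z \<in> prod.swap ` (SIGMA x:{..N}. {..<f x})" using z by (auto intro: rev_image_eqI)
    qed
  qed auto
  also have "\<dots> = (\<Sum>c<d. h c)" by simp
  finally show ?thesis .
qed

text \<open>Row \<open>x\<close> of the partition whose column lengths are the values of
  \<open>occ A i\<close>. Columns of partitions are numbered from 0, elements of the sets from 1,
  hence the \<open>Suc\<close> here and in \<open>sets_of\<close>.\<close>

definition chain_of :: "nat \<Rightarrow> (nat \<Rightarrow> nat set) \<Rightarrow> nat \<Rightarrow> nat \<Rightarrow> nat" where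
  "chain_of n A i x = (if i \<le> n then card {c. x < occ A i (Suc c)} else 0)"

definition sets_of :: "nat \<Rightarrow> (nat \<Rightarrow> nat \<Rightarrow> nat) \<Rightarrow> nat \<Rightarrow> nat set" where
  "sets_of n P i = (if i < n then {Suc c | c. \<exists>x. P i x \<le> c \<and> c < P (Suc i) x} else {})"

lemma set_seqs_subset: "C \<in> set_seqs N r d \<Longrightarrow> C t \<subseteq> {1..d}"
  by (cases "t < N") (auto simp: set_seqs_def)

lemma occ_out: "C \<in> set_seqs N r d \<Longrightarrow> k \<notin> {1..d} \<Longrightarrow> occ C t k = 0"
  using set_seqs_subset by (intro occ_eq_0) blast

text \<open>By the lattice condition the column lengths decrease weakly, so the columns longer than
  \<open>x\<close> form an initial segment.\<close>

lemma less_chain_of_iff: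
  assumes "A \<in> lattice_seqs n r d" "i \<le> n"
  shows "c < chain_of n A i x \<longleftrightarrow> x < occ A i (Suc c)"
proof -
  have A: "A \<in> set_seqs n r d" using assms by (simp add: lattice_seqs_def)
  have dec: "occ A i (Suc c') \<le> occ A i (Suc c)" if "c \<le> c'" for c c'
    by (rule lift_Suc_antimono_le[of "\<lambda>c. occ A i (Suc c)", OF _ that])
      (use assms in \<open>simp add: lattice_seqs_def\<close>)
  let ?X = "{c. x < occ A i (Suc c)}"
  have "?X \<subseteq> {..<d}" 
  proof
    fix c assume "c \<in> ?X"
    then have "Suc c \<in> {1..d}" using occ_out[OF A, of "Suc c" i] by fastforce
    then show "c \<in> {..<d}" by simp
  qed
  then have "?X = {..<card ?X}"
    by (intro finite_downset_eq_lessThan) (auto intro: finite_subset less_le_trans[OF _ dec])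
  then have "c \<in> ?X \<longleftrightarrow> c < card ?X" by blast
  then show ?thesis using assms(2) by (simp add: chain_of_def)
qed

text \<open>Serves both directions of the bijection: the size after \<open>i\<close> strips is the
  number of cells added, whether the sets or the chain are given.\<close>

lemma sum_eq_sum_card_of_conjugate:
  assumes "\<And>x c. c < f x \<longleftrightarrow> x < occ A i (Suc c)" "i \<le> n"
    and "\<And>t. A t \<subseteq> {1..d}"
  shows "(\<Sum>x\<le>n. f x) = (\<Sum>s<i. card (A s))"
proof -
  have occ: "occ A i (Suc c) = 0" if "c \<ge> d" for c
    using assms(3) that by (intro occ_eq_0) force
  have "(\<Sum>x\<le>n. f x) = (\<Sum>c<d. occ A i (Suc c))"
  proof (rule sum_conjugate[OF assms(1)])
    show "occ A i (Suc c) \<le> n" for c using occ_le[of A i "Suc c"] assms(2) by simp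
    show "f x \<le> d" for x using assms(1)[of d x] occ[of d] by (simp add: not_less[symmetric])
  qed
  also have "\<dots> = (\<Sum>k\<in>{1..d}. occ A i k)"
    by (rule sum.reindex_bij_witness[of _ "\<lambda>k. k - 1" Suc]) auto
  also have "\<dots> = (\<Sum>s<i. card (A s))" by (rule sum_occ) (rule assms)
  finally show ?thesis .
qed

text \<open>Each step lengthens a column by at most one cell, which is the condition for a
  horizontal strip.\<close>

lemma strip_chain_chain_of:
  assumes A: "A \<in> lattice_seqs n r d"
  shows "strip_chain n r (chain_of n A)" "chain_of n A n 0 \<le> d"
proof -
  note iff = less_chain_of_iff[OF A]
  have S: "A \<in> set_seqs n r d" using A by (simp add: lattice_seqs_def)
  have int: "interlace (chain_of n A i) (chain_of n A (Suc i))" if "i < n" for i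
    unfolding interlace_def
  proof (intro allI conjI)
    fix x
    show "chain_of n A i x \<le> chain_of n A (Suc i) x"
    proof (rule ccontr)
      assume "\<not> ?thesis"
      then have "chain_of n A (Suc i) x < chain_of n A i x" by simp
      \<comment> \<open>With the smaller row length as column index, \<open>iff\<close> passes to
        column lengths, which are monotone in \<open>i\<close>, and back.\<close>
      then have "chain_of n A (Suc i) x < chain_of n A (Suc i) x"
        using that by (subst (asm) iff, simp, subst iff) auto
      then show False by simp
    qed
    show "chain_of n A (Suc i) (Suc x) \<le> chain_of n A i x"
    proof (rule ccontr)
      assume "\<not> ?thesis"
      then have "chain_of n A i x < chain_of n A (Suc i) (Suc x)" by simp
      then have "chain_of n A i x < chain_of n A i x"
        using that by (subst (asm) iff, simp, subst iff) (auto split: if_splits)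
      then show False by simp
    qed
  qed
  have "(\<Sum>x\<le>n. chain_of n A i x) = r * i" if "i \<le> n" for i
  proof -
    have "(\<Sum>x\<le>n. chain_of n A i x) = (\<Sum>s<i. card (A s))"
      by (rule sum_eq_sum_card_of_conjugate[OF iff]) (use that set_seqs_subset[OF S] in auto)
    also have "\<dots> = (\<Sum>s<i. r)" using S that by (intro sum.cong) (auto simp: set_seqs_def)
    finally show ?thesis by simp
  qed
  then show "strip_chain n r (chain_of n A)"
    using int by (auto simp: strip_chain_def chain_of_def fun_eq_iff)
  show "chain_of n A n 0 \<le> d"
    using iff[of n d 0] occ_out[OF S, of "Suc d" n] by (simp add: not_less[symmetric])
qed

lemma set_seqs_eqI:
  assumes "A \<in> set_seqs n r d" "B \<in> set_seqs n r d"
    and "\<And>i k. i \<le> n \<Longrightarrow> occ A i k = occ B i k"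
  shows "A = B"
proof (intro ext set_eqI)
  fix i k
  show "k \<in> A i \<longleftrightarrow> k \<in> B i"
  proof (cases "i < n")
    case True
    then show ?thesis using assms(3)[of i k] assms(3)[of "Suc i" k] by (auto split: if_splits)
  next
    case False
    then show ?thesis using assms by (simp add: set_seqs_def)
  qed
qed

lemma less_nat_iff_imp_eq: "(\<And>x. x < a \<longleftrightarrow> x < b) \<Longrightarrow> a = (b :: nat)"
  by (metis linorder_cases less_irrefl)

lemma chain_of_eq_iff:
  assumes A: "A \<in> lattice_seqs n r d" and B: "B \<in> lattice_seqs n r d" and i: "i \<le> n"
  shows "chain_of n A i = chain_of n B i \<longleftrightarrow> (\<forall>k. occ A i k = occ B i k)"
proof
  assume eq: "chain_of n A i = chain_of n B i"
  show "\<forall>k. occ A i k = occ B i k"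
  proof
    fix k
    show "occ A i k = occ B i k"
    proof (cases k)
      case 0
      then show ?thesis using A B occ_out[of _ n r d 0] by (simp add: lattice_seqs_def)
    next
      case (Suc c)
      show ?thesis
        by (rule less_nat_iff_imp_eq)
          (simp add: Suc less_chain_of_iff[OF A i, symmetric] less_chain_of_iff[OF B i, symmetric] eq)
    qed
  qed
next
  assume eq: "\<forall>k. occ A i k = occ B i k"
  show "chain_of n A i = chain_of n B i"
    by (rule ext, rule less_nat_iff_imp_eq)
      (simp add: less_chain_of_iff[OF A i] less_chain_of_iff[OF B i] eq)
qed

text \<open>Induction over the strips. A horizontal strip meets a column in at most one cell, which
  lies just below the current end of the column; its row index is therefore the old length
  \<open>q\<close>.\<close>

lemma less_occ_sets_of_iff:
  assumes P: "strip_chain n r P" and "i \<le> n"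
  shows "x < occ (sets_of n P) i (Suc c) \<longleftrightarrow> c < P i x"
  using assms(2)
proof (induction i arbitrary: x)
  case 0
  then show ?case using P by (simp add: strip_chain_def)
next
  case (Suc i)
  define q where "q = occ (sets_of n P) i (Suc c)"
  have IH: "x < q \<longleftrightarrow> c < P i x" for x using Suc by (simp add: q_def)
  have "interlace (P i) (P (Suc i))" using P Suc.prems by (simp add: strip_chain_def)
  then have le: "P i x \<le> P (Suc i) x" "P (Suc i) (Suc x) \<le> P i x" for x
    by (auto simp: interlace_def)
  show ?case
  proof (cases "Suc c \<in> sets_of n P i")
    case True
    then obtain y where y: "P i y \<le> c" "c < P (Suc i) y"
      by (auto simp: sets_of_def split: if_splits)
    have "y = q"
    proof (cases y)
      case (Suc z)
      then show ?thesis using IH[of y] IH[of z] y le(2)[of z] by auto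
    qed (use IH[of y] y in auto)
    have "x < Suc q \<longleftrightarrow> c < P (Suc i) x"
    proof
      assume "x < Suc q"
      then show "c < P (Suc i) x" using IH[of x] le(1)[of x] y \<open>y = q\<close> by (cases "x = q") auto
    next
      assume x: "c < P (Suc i) x"
      show "x < Suc q"
      proof (cases x)
        case (Suc z)
        then show ?thesis using x le(2)[of z] IH[of z] by auto
      qed simp
    qed
    then show ?thesis using True by (simp add: q_def)
  next
    case False
    then have "c < P i x" if "c < P (Suc i) x" for x
      using that Suc.prems by (auto simp: sets_of_def not_less[symmetric])
    then show ?thesis using False IH[of x] le(1)[of x] by (auto simp: q_def)
  qed
qed

lemma sets_of_in_lattice_seqs:
  assumes P: "strip_chain n r P" and d: "P n 0 \<le> d"
  shows "sets_of n P \<in> lattice_seqs n r d"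
proof -
  note iff = less_occ_sets_of_iff[OF P]
  have sub: "sets_of n P i \<subseteq> {1..d}" for i
  proof
    fix k assume k: "k \<in> sets_of n P i"
    then obtain c where c: "k = Suc c" "i < n" by (auto simp: sets_of_def split: if_splits)
    then have "0 < occ (sets_of n P) (Suc i) (Suc c)" using k by simp
    also have "\<dots> \<le> occ (sets_of n P) n (Suc c)" using c by (intro occ_mono) simp
    finally have "c < P n 0" using iff by simp
    then show "k \<in> {1..d}" using c d by simp
  qed
  have sum: "(\<Sum>s<i. card (sets_of n P s)) = r * i" if "i \<le> n" for i
  proof -
    have "(\<Sum>x\<le>n. P i x) = (\<Sum>s<i. card (sets_of n P s))"
      by (rule sum_eq_sum_card_of_conjugate[OF _ that sub]) (simp add: iff that)
    then show ?thesis using P that by (simp add: strip_chain_def)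
  qed
  have "card (sets_of n P i) = r" if "i < n" for i
    using sum[of i] sum[of "Suc i"] that by simp
  then have "sets_of n P \<in> set_seqs n r d"
    using sub by (simp add: set_seqs_def) (simp add: sets_of_def)
  moreover have "occ (sets_of n P) t (Suc k) \<le> occ (sets_of n P) t k" if "t \<le> n" "k \<ge> 1" for t k
  proof (rule ccontr)
    assume "\<not> ?thesis"
    moreover obtain c where "k = Suc c" using \<open>k \<ge> 1\<close> by (cases k) auto
    \<comment> \<open>The row whose index is the length of column \<open>c\<close> would contain
      column \<open>Suc c\<close> but not column \<open>c\<close>.\<close>
    ultimately have "occ (sets_of n P) t (Suc c) < occ (sets_of n P) t (Suc (Suc c))" by simp
    then show False
      using iff[OF that(1), of "occ (sets_of n P) t (Suc c)" "Suc c"]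
        iff[OF that(1), of "occ (sets_of n P) t (Suc c)" c] by simp
  qed
  ultimately show ?thesis by (simp add: lattice_seqs_def)
qed

lemma bij_betw_chain_of:
  "bij_betw (chain_of n) (lattice_seqs n r d) {P. strip_chain n r P \<and> P n 0 \<le> d}"
  unfolding bij_betw_def
proof (intro conjI subset_antisym subsetI)
  show "inj_on (chain_of n) (lattice_seqs n r d)"
  proof (rule inj_onI)
    fix A B assume AB: "A \<in> lattice_seqs n r d" "B \<in> lattice_seqs n r d" "chain_of n A = chain_of n B"
    then show "A = B"
      using chain_of_eq_iff[OF AB(1,2)] set_seqs_eqI[of A n r d B]
      by (simp add: lattice_seqs_def)
  qed
next
  fix P assume "P \<in> chain_of n ` lattice_seqs n r d"
  then show "P \<in> {P. strip_chain n r P \<and> P n 0 \<le> d}"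
    using strip_chain_chain_of by blast
next
  fix P assume "P \<in> {P. strip_chain n r P \<and> P n 0 \<le> d}"
  then have P: "strip_chain n r P" "P n 0 \<le> d" by auto
  note A = sets_of_in_lattice_seqs[OF this]
  have "chain_of n (sets_of n P) i x = P i x" for i x
  proof (cases "i \<le> n")
    case True
    show ?thesis
      by (rule less_nat_iff_imp_eq)
        (simp add: less_chain_of_iff[OF A True] less_occ_sets_of_iff[OF P(1) True])
  next
    case False
    then show ?thesis using P by (simp add: chain_of_def strip_chain_def)
  qed
  then have "chain_of n (sets_of n P) = P" by auto
  then show "P \<in> chain_of n ` lattice_seqs n r d" using A by (metis image_eqI)
qed

text \<open>Used for chains with a common end and for tableaux of a common shape.\<close>

lemma bij_betw_related_pairs:
  assumes "bij_betw f A B" "\<And>x y. x \<in> A \<Longrightarrow> y \<in> A \<Longrightarrow> R x y \<longleftrightarrow> R' (f x) (f y)"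
  shows "bij_betw (map_prod f f) {(x, y). x \<in> A \<and> y \<in> A \<and> R x y}
           {(x, y). x \<in> B \<and> y \<in> B \<and> R' x y}"
proof (rule bij_betw_imageI)
  show "inj_on (map_prod f f) {(x, y). x \<in> A \<and> y \<in> A \<and> R x y}"
    using bij_betw_imp_inj_on[OF assms(1)] by (auto simp: inj_on_def)
  have B: "B = f ` A" using assms(1) by (simp add: bij_betw_def)
  show "map_prod f f ` {(x, y). x \<in> A \<and> y \<in> A \<and> R x y} = {(x, y). x \<in> B \<and> y \<in> B \<and> R' x y}"
    unfolding B using assms(2) by (auto simp: image_iff split: prod.splits)
qed

text \<open>Both the tableaux and the signed walks are compared with \<open>g_hat\<close> through
  this number.\<close>

lemma g_hat_eq_card_lattice_seqs:
  "g_hat n r d = card {(A, B). A \<in> lattice_seqs n r d \<and> B \<in> lattice_seqs n r d \<and>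
                               (\<forall>k. occ A n k = occ B n k)}"
proof -
  have "g_hat n r d = card {M. reg_bip_multigraph n r M \<and> growth M n n 0 \<le> d}"
    by (simp add: g_hat_def planar_le_iff_growth)
  also have "\<dots> = card {(P, Q). strip_chain n r P \<and> strip_chain n r Q \<and> P n = Q n \<and> P n 0 \<le> d}"
    by (rule bij_betw_same_card[OF bij_betw_growth_boundary])
  also have "{(P, Q). strip_chain n r P \<and> strip_chain n r Q \<and> P n = Q n \<and> P n 0 \<le> d} =
      {(P, Q). P \<in> {P. strip_chain n r P \<and> P n 0 \<le> d} \<and> Q \<in> {P. strip_chain n r P \<and> P n 0 \<le> d} \<and>
               P n = Q n}"
    by auto
  also have "card \<dots> = card {(A, B). A \<in> lattice_seqs n r d \<and> B \<in> lattice_seqs n r d \<and>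
                               (\<forall>k. occ A n k = occ B n k)}"
    by (rule bij_betw_same_card[symmetric], rule bij_betw_related_pairs[OF bij_betw_chain_of])
      (simp add: chain_of_eq_iff)
  finally show ?thesis .
qed

section \<open>Words with strictly increasing blocks\<close>

definition block :: "nat \<Rightarrow> nat \<Rightarrow> 'a list \<Rightarrow> 'a list" where
  "block r t w = take r (drop (r * t) w)"

definition block_words :: "nat \<Rightarrow> nat \<Rightarrow> nat \<Rightarrow> nat list set" where
  "block_words N r d = {w. length w = r * N \<and> set w \<subseteq> {1..d} \<and>
     (\<forall>t<N. sorted_wrt (<) (block r t w))}"

definition block_sets :: "nat \<Rightarrow> nat \<Rightarrow> nat list \<Rightarrow> nat \<Rightarrow> nat set" where
  "block_sets N r w t = (if t < N then set (block r t w) else {})"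

lemma block_end_le: "t < N \<Longrightarrow> r * t + r \<le> r * (N :: nat)"
  by (metis Suc_leI mult_Suc_right mult_le_mono2 add.commute)

lemma length_block: "length w = r * N \<Longrightarrow> t < N \<Longrightarrow> length (block r t w) = r"
  using block_end_le[of t N r] by (auto simp: block_def)

lemma nth_block: "length w = r * N \<Longrightarrow> t < N \<Longrightarrow> s < r \<Longrightarrow> block r t w ! s = w ! (r * t + s)"
  using block_end_le[of t N r] by (auto simp: block_def)

lemma take_Suc_block: "take (r * Suc t) w = take (r * t) w @ block r t w"
proof -
  have "take (r * Suc t) w = take (r * t + r) w" by (simp add: add.commute)
  then show ?thesis by (simp only: block_def take_add)
qed

lemma take_eq_concat_blocks: "take (r * t) w = concat (map (\<lambda>t. block r t w) [0..<t])"
  by (induction t) (simp_all add: take_Suc_block del: mult_Suc_right)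

lemma sorted_block_iff:
  assumes "length w = r * N" "t < N"
  shows "sorted_wrt (<) (block r t w) \<longleftrightarrow>
         (\<forall>s. Suc s < r \<longrightarrow> w ! (r * t + s) < (w ! (r * t + Suc s) :: nat))"
  using nth_block[OF assms]
  by (simp add: sorted_wrt_iff_nth_Suc_transp length_block[OF assms] Suc_lessD cong: imp_cong)

text \<open>\<open>i\<close> and \<open>s\<close> count from 1, blocks and list positions from 0:
  block \<open>t\<close> belongs to \<open>i = t + 1\<close>.\<close>

lemma sorted_blocks_iff_ascents:
  assumes "length w = r * N"
  shows "(\<forall>t<N. sorted_wrt (<) (block r t w)) \<longleftrightarrow>
    (\<forall>i\<in>{1..N}. \<forall>s. 1 \<le> s \<and> s < r \<longrightarrow> w ! (r * (i - 1) + s - 1) < (w ! (r * (i - 1) + s) :: nat))"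
proof (intro iffI ballI allI impI)
  fix i s assume *: "\<forall>t<N. sorted_wrt (<) (block r t w)" "i \<in> {1..N}" "1 \<le> s \<and> s < r"
  then obtain s' where "s = Suc s'" "i - 1 < N" by (cases s) auto
  then show "w ! (r * (i - 1) + s - 1) < w ! (r * (i - 1) + s)"
    using * sorted_block_iff[OF assms, of "i - 1"] by auto
next
  fix t assume *: "\<forall>i\<in>{1..N}. \<forall>s. 1 \<le> s \<and> s < r \<longrightarrow>
      w ! (r * (i - 1) + s - 1) < w ! (r * (i - 1) + s)" and t: "t < N"
  show "sorted_wrt (<) (block r t w)"
    unfolding sorted_block_iff[OF assms t]
  proof (intro allI impI)
    fix s assume "Suc s < r"
    then show "w ! (r * t + s) < w ! (r * t + Suc s)"
      using *[THEN bspec[of _ _ "Suc t"], rule_format, of "Suc s"] t by simp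
  qed
qed

lemma block_sets_in_set_seqs:
  assumes "w \<in> block_words N r d"
  shows "block_sets N r w \<in> set_seqs N r d"
proof -
  have w: "length w = r * N" "set w \<subseteq> {1..d}" "\<And>t. t < N \<Longrightarrow> sorted_wrt (<) (block r t w)"
    using assms by (auto simp: block_words_def)
  have "card (set (block r t w)) = r" if "t < N" for t
    using w(3)[OF that] length_block[OF w(1) that]
    by (simp add: strict_sorted_iff distinct_card)
  moreover have "set (block r t w) \<subseteq> {1..d}" for t
    using w(2) by (auto simp: block_def dest!: in_set_takeD in_set_dropD)
  ultimately show ?thesis by (auto simp: set_seqs_def block_sets_def)
qed

text \<open>A strictly increasing list is determined by its set of entries, and every
  \<open>r\<close>-set sorts to such a list, block by block.\<close>

lemma bij_betw_block_sets: "bij_betw (block_sets N r) (block_words N r d) (set_seqs N r d)"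
  unfolding bij_betw_def
proof (intro conjI subset_antisym subsetI)
  show "inj_on (block_sets N r) (block_words N r d)"
  proof (rule inj_onI)
    fix v w assume v: "v \<in> block_words N r d" and w: "w \<in> block_words N r d"
      and eq: "block_sets N r v = block_sets N r w"
    have "block r t v = block r t w" if "t < N" for t
    proof (rule strict_sorted_equal)
      show "sorted_wrt (<) (block r t v)" "sorted_wrt (<) (block r t w)"
        using v w that by (auto simp: block_words_def)
      show "set (block r t v) = set (block r t w)"
        using fun_cong[OF eq, of t] that by (simp add: block_sets_def)
    qed
    then have "take (r * N) v = take (r * N) w"
      unfolding take_eq_concat_blocks by (auto intro!: arg_cong[of _ _ concat])
    then show "v = w" using v w by (simp add: block_words_def)
  qed
next
  fix C assume "C \<in> block_sets N r ` block_words N r d"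
  then show "C \<in> set_seqs N r d" using block_sets_in_set_seqs by blast
next
  fix C assume C: "C \<in> set_seqs N r d"
  define f where "f = (\<lambda>t. sorted_list_of_set (C t))"
  define w where "w = concat (map f [0..<N])"
  have fin: "finite (C t)" for t using set_seqs_subset[OF C, of t] by (rule finite_subset) simp
  have lenf: "length (f t) = r" if "t < N" for t
    using C that by (simp add: f_def set_seqs_def)
  have len: "length (concat (map f [0..<t])) = r * t" if "t \<le> N" for t
    using that lenf by (induction t) auto
  have blk: "block r t w = f t" if "t < N" for t
  proof -
    have "[0..<N] = [0..<t] @ t # [Suc t..<N]"
      using that by (metis upt_add_eq_append upt_conv_Cons le_add_diff_inverse less_imp_le zero_le)
    then have "w = concat (map f [0..<t]) @ f t @ concat (map f [Suc t..<N])"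
      by (simp add: w_def)
    then show ?thesis using len[of t] lenf[OF that] that by (simp add: block_def)
  qed
  have "set w \<subseteq> {1..d}"
    using set_seqs_subset[OF C] fin by (auto simp: w_def f_def)
  then have "w \<in> block_words N r d"
    using len[of N] blk unfolding w_def[symmetric] by (simp add: block_words_def f_def)
  moreover have "block_sets N r w = C"
    using blk fin C by (auto simp: block_sets_def f_def fun_eq_iff set_seqs_def)
  ultimately show "C \<in> block_sets N r ` block_words N r d" by blast
qed

lemma finite_set_seqs: "finite (set_seqs N r d)"
proof -
  have "block_words N r d \<subseteq> {w. set w \<subseteq> {1..d} \<and> length w = r * N}"
    by (auto simp: block_words_def)
  then have "finite (block_words N r d)"
    by (rule finite_subset) (simp add: finite_lists_length_eq)
  then show ?thesis using bij_betw_finite[OF bij_betw_block_sets] by blast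
qed

lemma count_list_distinct: "distinct xs \<Longrightarrow> count_list xs k = (if k \<in> set xs then 1 else 0)"
  by (induction xs) auto

text \<open>Entries within a block are distinct, so at block ends the letter count is the number of
  blocks containing the letter.\<close>

lemma occ_block_sets:
  assumes "w \<in> block_words N r d" "t \<le> N"
  shows "occ (block_sets N r w) t k = count_list (take (r * t) w) k"
  using assms(2)
proof (induction t)
  case (Suc t)
  then have "distinct (block r t w)"
    using assms(1) by (auto simp: block_words_def strict_sorted_iff)
  then show ?case
    using Suc by (simp add: take_Suc_block count_list_distinct block_sets_def del: mult_Suc_right)
qed simp

section \<open>The reflection principle\<close>

text \<open>The coordinates are shifted by \<open>- k\<close>, so that an end point \<open>T(\<pi>)\<close> becomes \<open>- \<pi>\<close>, and swapping two
  coordinates composes \<open>\<pi>\<close> with a transposition. Steps are whole blocks, positive before time \<open>n\<close> and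
  negative afterwards.\<close>
definition walk_pos :: "nat \<Rightarrow> (nat \<Rightarrow> nat set) \<Rightarrow> nat \<Rightarrow> nat \<Rightarrow> int" where
  "walk_pos n C t k = (\<Sum>s<t. (if s < n then 1 else - 1) * (if k \<in> C s then 1 else 0)) - int k"

lemma walk_pos_0 [simp]: "walk_pos n C 0 k = - int k"
  by (simp add: walk_pos_def)

lemma walk_pos_Suc: "walk_pos n C (Suc t) k =
    walk_pos n C t k + (if t < n then 1 else - 1) * (if k \<in> C t then 1 else 0)"
  by (simp add: walk_pos_def)

lemma walk_pos_eq_occ: "t \<le> n \<Longrightarrow> walk_pos n C t k = int (occ C t k) - int k"
  by (induction t) (auto simp: walk_pos_Suc)

lemma walk_pos_add_eq_occ:
  "walk_pos n C (n + t) k = int (occ C n k) - int (occ (\<lambda>s. C (n + s)) t k) - int k"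
  by (induction t) (auto simp: walk_pos_Suc walk_pos_eq_occ)

definition walks :: "nat \<Rightarrow> nat \<Rightarrow> nat \<Rightarrow> (nat \<Rightarrow> nat) \<Rightarrow> (nat \<Rightarrow> nat set) set" where
  "walks n r d p = {C \<in> set_seqs (2 * n) r d. \<forall>k\<in>{1..d}. walk_pos n C (2 * n) k = - int (p k)}"

definition touches :: "nat \<Rightarrow> nat \<Rightarrow> (nat \<Rightarrow> nat set) \<Rightarrow> nat \<Rightarrow> nat \<Rightarrow> bool" where
  "touches n d C t k \<longleftrightarrow> k \<in> {1..<d} \<and> walk_pos n C t k = walk_pos n C t (Suc k)"

definition touching :: "nat \<Rightarrow> nat \<Rightarrow> (nat \<Rightarrow> nat set) \<Rightarrow> bool" where
  "touching n d C \<longleftrightarrow> (\<exists>t\<le>2 * n. \<exists>k. touches n d C t k)"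

definition touch_time :: "nat \<Rightarrow> nat \<Rightarrow> (nat \<Rightarrow> nat set) \<Rightarrow> nat" where
  "touch_time n d C = (LEAST t. \<exists>k. touches n d C t k)"

text \<open>Several walls may be met at the first touching time; the least one is a choice that
  depends only on the position at that time.\<close>

definition touch_wall :: "nat \<Rightarrow> nat \<Rightarrow> (nat \<Rightarrow> nat set) \<Rightarrow> nat" where
  "touch_wall n d C = (LEAST k. touches n d C (touch_time n d C) k)"

definition wall_swap :: "nat \<Rightarrow> nat \<Rightarrow> (nat \<Rightarrow> nat set) \<Rightarrow> nat \<Rightarrow> nat" where
  "wall_swap n d C = transpose (touch_wall n d C) (Suc (touch_wall n d C))"

text \<open>Step \<open>s\<close> leads from time \<open>s\<close> to time \<open>s + 1\<close>, so
  swapping starts at index \<open>touch_time n d C\<close>.\<close>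

definition reflect :: "nat \<Rightarrow> nat \<Rightarrow> (nat \<Rightarrow> nat set) \<Rightarrow> nat \<Rightarrow> nat set" where
  "reflect n d C s = (if s < touch_time n d C then C s else wall_swap n d C ` C s)"

context
  fixes n d :: nat and C :: "nat \<Rightarrow> nat set"
  assumes touching: "touching n d C"
begin

lemma touches_first: "touches n d C (touch_time n d C) (touch_wall n d C)"
  and touch_time_le: "touch_time n d C \<le> 2 * n"
proof -
  obtain t k where tk: "t \<le> 2 * n" "touches n d C t k" using touching by (auto simp: touching_def)
  then have "\<exists>k. touches n d C (touch_time n d C) k"
    using LeastI[of "\<lambda>t. \<exists>k. touches n d C t k" t] by (auto simp: touch_time_def)
  then show "touches n d C (touch_time n d C) (touch_wall n d C)"
    unfolding touch_wall_def by (rule LeastI_ex)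
  show "touch_time n d C \<le> 2 * n"
    using tk Least_le[of "\<lambda>t. \<exists>k. touches n d C t k" t]
    unfolding touch_time_def by (meson order_trans)
qed

lemma wall_swap_permutes: "wall_swap n d C permutes {1..d}"
  using touches_first unfolding wall_swap_def by (intro permutes_swap_id) (auto simp: touches_def)

lemma wall_swap_wall_swap [simp]: "wall_swap n d C (wall_swap n d C k) = k"
  by (simp add: wall_swap_def)

lemma walk_pos_reflect_before:
  assumes "t \<le> touch_time n d C"
  shows "walk_pos n (reflect n d C) t k = walk_pos n C t k"
  using assms by (induction t) (auto simp: walk_pos_Suc reflect_def)

lemma touches_reflect:
  "t \<le> touch_time n d C \<Longrightarrow> touches n d (reflect n d C) t k \<longleftrightarrow> touches n d C t k"
  by (simp add: touches_def walk_pos_reflect_before)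

lemma touch_time_reflect: "touch_time n d (reflect n d C) = touch_time n d C"
  unfolding touch_time_def[of n d "reflect n d C"]
proof (rule Least_equality)
  show "\<exists>k. touches n d (reflect n d C) (touch_time n d C) k"
    using touches_first touches_reflect by blast
next
  fix t assume "\<exists>k. touches n d (reflect n d C) t k"
  then obtain k where k: "touches n d (reflect n d C) t k" ..
  show "touch_time n d C \<le> t"
  proof (rule ccontr)
    assume "\<not> ?thesis"
    then have "touches n d C t k" "t < touch_time n d C" using k touches_reflect by auto
    then show False unfolding touch_time_def by (auto dest: not_less_Least)
  qed
qed

lemma touch_wall_reflect: "touch_wall n d (reflect n d C) = touch_wall n d C"
  by (simp add: touch_wall_def touch_time_reflect touches_reflect)

lemma touching_reflect: "touching n d (reflect n d C)"
  using touches_first touch_time_le touches_reflect[OF order_refl] by (auto simp: touching_def)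

text \<open>The first touching time and its wall depend only on the walk up to that time, which
  \<open>reflect\<close> leaves alone; hence the same swap is applied twice.\<close>

lemma reflect_reflect: "reflect n d (reflect n d C) = C"
proof -
  have "wall_swap n d (reflect n d C) = wall_swap n d C"
    by (simp add: wall_swap_def touch_wall_reflect)
  then show ?thesis
    by (auto simp: reflect_def[of n d "reflect n d C"] touch_time_reflect fun_eq_iff)
      (auto simp: reflect_def image_image)
qed

text \<open>At the touching time the two swapped coordinates are equal, so the swap fixes the
  position; all later steps are swapped with it.\<close>

lemma walk_pos_reflect_after:
  assumes "touch_time n d C \<le> t"
  shows "walk_pos n (reflect n d C) t k = walk_pos n C t (wall_swap n d C k)"
  using assms
proof (induction t rule: dec_induct)
  case base
  have "walk_pos n C (touch_time n d C) k = walk_pos n C (touch_time n d C) (wall_swap n d C k)"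
    using touches_first by (auto simp: wall_swap_def transpose_def touches_def)
  then show ?case by (simp add: walk_pos_reflect_before)
next
  case (step t)
  have "k \<in> wall_swap n d C ` C t \<longleftrightarrow> wall_swap n d C k \<in> C t"
    by (metis image_iff wall_swap_wall_swap)
  then show ?case using step by (simp add: walk_pos_Suc reflect_def)
qed

lemma reflect_in_walks:
  assumes "C \<in> walks n r d p"
  shows "reflect n d C \<in> walks n r d (p \<circ> wall_swap n d C)"
proof -
  have C: "C \<in> set_seqs (2 * n) r d" using assms by (simp add: walks_def)
  have "inj (wall_swap n d C)" by (simp add: wall_swap_def)
  then have "card (wall_swap n d C ` C t) = card (C t)" for t
    by (intro card_image) (rule inj_on_subset, auto)
  moreover have "wall_swap n d C ` X \<subseteq> {1..d}" if "X \<subseteq> {1..d}" for X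
    using permutes_image[OF wall_swap_permutes] that by blast
  ultimately have "reflect n d C \<in> set_seqs (2 * n) r d"
    using C by (auto simp: set_seqs_def reflect_def)
  moreover have "walk_pos n (reflect n d C) (2 * n) k = - int (p (wall_swap n d C k))" if "k \<in> {1..d}" for k
  proof -
    have "wall_swap n d C k \<in> {1..d}" using permutes_in_image[OF wall_swap_permutes] that by blast
    then show ?thesis using assms walk_pos_reflect_after[OF touch_time_le, of k] by (simp add: walks_def)
  qed
  ultimately show ?thesis by (simp add: walks_def)
qed

end

section \<open>The signed count of walks\<close>

text \<open>\<open>reflect\<close>, together with composing \<open>p\<close> with the wall swap, is
  a sign-reversing involution on pairs of a permutation and a touching walk, so the sum equals its
  own negative.\<close>

lemma sum_touching_walks_eq_0:
  "(\<Sum>p | p permutes {1..d}. sign p * int (card {C \<in> walks n r d p. touching n d C})) = 0"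
proof -
  define X where "X = (SIGMA p:{p. p permutes {1..d}}. {C \<in> walks n r d p. touching n d C})"
  define f where "f = (\<lambda>(p :: nat \<Rightarrow> nat, C). (p \<circ> wall_swap n d C, reflect n d C))"
  have fin: "finite {C \<in> walks n r d p. touching n d C}" for p
    by (rule finite_subset[OF _ finite_set_seqs[of "2 * n" r d]]) (auto simp: walks_def)
  have "(\<Sum>p | p permutes {1..d}. sign p * int (card {C \<in> walks n r d p. touching n d C})) =
      (\<Sum>p | p permutes {1..d}. \<Sum>C\<in>{C \<in> walks n r d p. touching n d C}. sign p)"
    by (simp add: mult.commute)
  also have "\<dots> = (\<Sum>z\<in>X. sign (fst z))"
    unfolding X_def by (subst sum.Sigma) (auto simp: fin finite_permutations case_prod_unfold)
  finally have eq: "(\<Sum>p | p permutes {1..d}. sign p * int (card {C \<in> walks n r d p. touching n d C})) =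
      (\<Sum>z\<in>X. sign (fst z))" .
  have fX: "f z \<in> X" and ff: "f (f z) = z" and sf: "sign (fst (f z)) = - sign (fst z)" if zX: "z \<in> X" for z
  proof -
    obtain p C where z: "z = (p, C)" "p permutes {1..d}" "C \<in> walks n r d p" "touching n d C"
      using zX by (auto simp: X_def)
    note ws = wall_swap_permutes[OF z(4)]
    show "f z \<in> X"
      using z reflect_in_walks touching_reflect permutes_compose[OF ws z(2)] by (simp add: f_def X_def)
    have "wall_swap n d (reflect n d C) = wall_swap n d C"
      by (simp add: wall_swap_def touch_wall_reflect z)
    then show "f (f z) = z"
      by (simp add: f_def z reflect_reflect wall_swap_wall_swap[OF z(4)] fun_eq_iff)
    have "sign (wall_swap n d C) = - 1"
      by (simp add: wall_swap_def sign_swap_id)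
    moreover have "sign (p \<circ> wall_swap n d C) = sign p * sign (wall_swap n d C)"
      by (rule sign_compose) (use z(2) ws permutation_permutes in \<open>blast+\<close>)
    ultimately show "sign (fst (f z)) = - sign (fst z)" by (simp add: f_def z)
  qed
  have "(\<Sum>z\<in>X. sign (fst z)) = (\<Sum>z\<in>X. - sign (fst z))"
    by (rule sum.reindex_bij_witness[of _ f f]) (use fX ff sf in auto)
  then show ?thesis unfolding eq by (simp add: sum_negf)
qed

text \<open>A block moves several coordinates at once, but each by at most one and all in the same
  direction, so a difference of two coordinates changes by at most one.\<close>

lemma walk_pos_step:
  "\<bar>(walk_pos n C (Suc t) k - walk_pos n C (Suc t) l) - (walk_pos n C t k - walk_pos n C t l)\<bar> \<le> 1"
  by (auto simp: walk_pos_Suc)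

text \<open>A discrete intermediate value argument: each difference of neighbouring coordinates
  starts at 1 and cannot become negative without being 0 first.\<close>

lemma not_touching_iff:
  "\<not> touching n d C \<longleftrightarrow> (\<forall>t\<le>2 * n. \<forall>k\<in>{1..<d}. walk_pos n C t (Suc k) < walk_pos n C t k)"
proof
  assume nt: "\<not> touching n d C"
  show "\<forall>t\<le>2 * n. \<forall>k\<in>{1..<d}. walk_pos n C t (Suc k) < walk_pos n C t k"
  proof (intro allI impI ballI)
    fix t k assume "t \<le> 2 * n" and k: "k \<in> {1..<d}"
    then show "walk_pos n C t (Suc k) < walk_pos n C t k"
    proof (induction t)
      case (Suc t)
      have "walk_pos n C (Suc t) k \<noteq> walk_pos n C (Suc t) (Suc k)"
        using nt Suc.prems by (auto simp: touching_def touches_def)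
      then show ?case using Suc walk_pos_step[of n C t k "Suc k"] by auto
    qed simp
  qed
qed (force simp: touching_def touches_def)

text \<open>The coordinates of the end point decrease strictly, so \<open>p\<close> increases
  strictly on \<open>{1..d}\<close>.\<close>

lemma not_touching_end:
  assumes "p permutes {1..d}" "C \<in> walks n r d p" "\<not> touching n d C"
  shows "p = id"
proof -
  have lt: "p k < p (Suc k)" if "k \<in> {1..<d}" for k
  proof -
    have "walk_pos n C (2 * n) (Suc k) < walk_pos n C (2 * n) k" using assms(3) that by (simp add: not_touching_iff)
    then show ?thesis using assms(2) that by (simp add: walks_def)
  qed
  have ge: "k \<le> p k" if "k \<in> {1..d}" for k
    using that
  proof (induction k)
    case (Suc k)
    show ?case
    proof (cases "k = 0")
      case True
      have "p (Suc k) \<in> {1..d}" using Suc.prems permutes_in_image[OF assms(1)] by blast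
      then show ?thesis using True by simp
    next
      case False
      then show ?thesis using Suc lt[of k] by simp
    qed
  qed simp
  \<comment> \<open>A permutation preserves the sum, so none of the inequalities
    \<open>k \<le> p k\<close> can be strict.\<close>
  have "sum p {1..d} = sum id {1..d}"
    using sum.permute[OF assms(1), of id] by simp
  have "p k = k" if "k \<in> {1..d}" for k
  proof (rule ccontr)
    assume "p k \<noteq> k"
    then have "k < p k" using ge[OF that] by simp
    then have "sum id {1..d} < sum p {1..d}"
      using ge that by (intro sum_strict_mono_ex1) auto
    then show False using \<open>sum p {1..d} = sum id {1..d}\<close> by simp
  qed
  then show ?thesis using assms(1) by (auto simp: fun_eq_iff permutes_def)
qed

lemma signed_walks_eq_not_touching:
  "(\<Sum>p | p permutes {1..d}. sign p * int (card (walks n r d p))) =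
    int (card {C \<in> walks n r d id. \<not> touching n d C})"
proof -
  have fin: "finite (walks n r d p)" for p
    by (rule finite_subset[OF _ finite_set_seqs[of "2 * n" r d]]) (auto simp: walks_def)
  have "card (walks n r d p) = card {C \<in> walks n r d p. touching n d C} +
      card {C \<in> walks n r d p. \<not> touching n d C}" for p
    by (subst card_Un_disjoint[symmetric]) (auto simp: fin intro: arg_cong[of _ _ card])
  then have "(\<Sum>p | p permutes {1..d}. sign p * int (card (walks n r d p))) =
      (\<Sum>p | p permutes {1..d}. sign p * int (card {C \<in> walks n r d p. touching n d C})) +
      (\<Sum>p | p permutes {1..d}. sign p * int (card {C \<in> walks n r d p. \<not> touching n d C}))"
    by (simp add: sum.distrib distrib_left)
  also have "\<dots> = (\<Sum>p\<in>{id}. sign p * int (card {C \<in> walks n r d p. \<not> touching n d C}))"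
    unfolding sum_touching_walks_eq_0 add_0_left
  proof (rule sum.mono_neutral_right)
    show "\<forall>p\<in>{p. p permutes {1..d}} - {id}. sign p * int (card {C \<in> walks n r d p. \<not> touching n d C}) = 0"
    proof
      fix p assume "p \<in> {p. p permutes {1..d}} - {id}"
      then have "{C \<in> walks n r d p. \<not> touching n d C} = {}" using not_touching_end by blast
      then show "sign p * int (card {C \<in> walks n r d p. \<not> touching n d C}) = 0"
        by (simp only: card.empty)
    qed
  qed (auto simp: finite_permutations permutes_id)
  finally show ?thesis by simp
qed

section \<open>Splitting a returning walk into two lattice sequences\<close>

lemma bij_betw_Collect_pullback:
  assumes "bij_betw f A B"
  shows "bij_betw f {x \<in> A. Q (f x)} {y \<in> B. Q y}"
  using assms by (auto simp: bij_betw_def inj_on_def)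

lemma occ_add: "occ C (m + t) k = occ C m k + occ (\<lambda>s. C (m + s)) t k"
  by (induction t) auto

lemma occ_rev:
  "t \<le> n \<Longrightarrow> occ (\<lambda>s. B (n - 1 - s)) t k + occ B (n - t) k = occ B n k"
proof (induction t)
  case (Suc t)
  then have "n - t = Suc (n - Suc t)" by simp
  then show ?case using Suc by simp
qed simp

lemma occ_cong: "(\<And>s. s < t \<Longrightarrow> C s = C' s) \<Longrightarrow> occ C t k = occ C' t k"
  by (induction t) auto

text \<open>The second half is read backwards, so for a walk that returns to its start both
  sequences lead from there to the position at time \<open>n\<close>.\<close>

definition halves :: "nat \<Rightarrow> (nat \<Rightarrow> nat set) \<Rightarrow> (nat \<Rightarrow> nat set) \<times> (nat \<Rightarrow> nat set)" where
  "halves n C = (\<lambda>t. if t < n then C t else {}, \<lambda>t. if t < n then C (2 * n - 1 - t) else {})"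

lemma bij_betw_halves:
  "bij_betw (halves n) (set_seqs (2 * n) r d) (set_seqs n r d \<times> set_seqs n r d)"
proof (rule bij_betw_byWitness)
  let ?g = "\<lambda>(A, B) t. if t < n then A t else if t < 2 * n then B (2 * n - 1 - t) else ({} :: nat set)"
  show "\<forall>C\<in>set_seqs (2 * n) r d. ?g (halves n C) = C"
    by (auto simp: halves_def set_seqs_def fun_eq_iff)
  show "\<forall>z\<in>set_seqs n r d \<times> set_seqs n r d. halves n (?g z) = z"
    by (auto simp: halves_def set_seqs_def fun_eq_iff)
  show "halves n ` set_seqs (2 * n) r d \<subseteq> set_seqs n r d \<times> set_seqs n r d"
    by (clarsimp simp: halves_def set_seqs_def)
  show "?g ` (set_seqs n r d \<times> set_seqs n r d) \<subseteq> set_seqs (2 * n) r d"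
    by (clarsimp simp: set_seqs_def)
qed

text \<open>For a returning walk, the position at time \<open>2 * n - t\<close> is given by the
  first \<open>t\<close> sets of \<open>B\<close>. In shifted coordinates, coordinate
  \<open>k\<close> exceeds coordinate \<open>Suc k\<close> exactly if \<open>Suc k\<close> has
  occurred at most as often as \<open>k\<close>.\<close>

lemma halves_lattice_iff:
  assumes C: "C \<in> set_seqs (2 * n) r d" and h: "halves n C = (A, B)"
  shows "C \<in> walks n r d id \<and> \<not> touching n d C \<longleftrightarrow>
    A \<in> lattice_seqs n r d \<and> B \<in> lattice_seqs n r d \<and> (\<forall>k. occ A n k = occ B n k)"
proof -
  have AB: "A \<in> set_seqs n r d" "B \<in> set_seqs n r d"
    using bij_betwE[OF bij_betw_halves, of n r d] C h by auto
  have C1: "C t = A t" and C2: "C (n + t) = B (n - 1 - t)" if "t < n" for t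
    using h that by (auto simp: halves_def)
  have p1: "walk_pos n C t k = int (occ A t k) - int k" if "t \<le> n" for t k
    using walk_pos_eq_occ[OF that] occ_cong[of t C A k] C1 that by simp
  have p2: "walk_pos n C (n + t) k = int (occ A n k) - int (occ B n k) + int (occ B (n - t) k) - int k"
    if "t \<le> n" for t k
  proof -
    have "occ (\<lambda>s. C (n + s)) t k = occ (\<lambda>s. B (n - 1 - s)) t k"
      using C2 that by (intro occ_cong) simp
    moreover have "occ C n k = occ A n k" using C1 by (intro occ_cong)
    ultimately show ?thesis using occ_rev[OF that, of B k] by (simp add: walk_pos_add_eq_occ)
  qed
  have walk: "C \<in> walks n r d id \<longleftrightarrow> (\<forall>k. occ A n k = occ B n k)"
  proof -
    have "occ A n k = occ B n k" if "k \<notin> {1..d}" for k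
      using that AB by (simp add: occ_out)
    moreover have "walk_pos n C (2 * n) k = - int (id k) \<longleftrightarrow> occ A n k = occ B n k" for k
      using p2[of n k] by (simp add: mult_2)
    ultimately show ?thesis using C by (auto simp: walks_def)
  qed
  have "\<not> touching n d C \<longleftrightarrow> A \<in> lattice_seqs n r d \<and> B \<in> lattice_seqs n r d"
    if eq: "\<forall>k. occ A n k = occ B n k"
  proof -
    \<comment> \<open>For \<open>k \<ge> d\<close> the count of \<open>Suc k\<close> is zero, so
      only the walls with \<open>k < d\<close> matter.\<close>
    have *: "X \<in> lattice_seqs n r d \<longleftrightarrow> (\<forall>t\<le>n. \<forall>k\<in>{1..<d}. occ X t (Suc k) \<le> occ X t k)"
      if "X \<in> set_seqs n r d" for X
    proof -
      have "occ X t (Suc k) \<le> occ X t k" if "k \<ge> d" for t k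
        using occ_out[OF \<open>X \<in> set_seqs n r d\<close>, of "Suc k" t] that by simp
      then have "(\<forall>k\<ge>1. occ X t (Suc k) \<le> occ X t k) \<longleftrightarrow>
          (\<forall>k\<in>{1..<d}. occ X t (Suc k) \<le> occ X t k)" for t
        by (metis atLeastLessThan_iff not_less)
      then show ?thesis using that by (simp add: lattice_seqs_def)
    qed
    \<comment> \<open>Time is split at \<open>n\<close>, and the second half is parametrised as
      \<open>n + (n - t)\<close> to match the prefixes of \<open>B\<close>.\<close>
    have "\<not> touching n d C \<longleftrightarrow> (\<forall>t\<le>n. \<forall>k\<in>{1..<d}. walk_pos n C t (Suc k) < walk_pos n C t k) \<and>
        (\<forall>t\<le>n. \<forall>k\<in>{1..<d}. walk_pos n C (n + (n - t)) (Suc k) < walk_pos n C (n + (n - t)) k)"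
      unfolding not_touching_iff
    proof (intro iffI conjI allI impI)
      fix t assume "(\<forall>t\<le>n. \<forall>k\<in>{1..<d}. walk_pos n C t (Suc k) < walk_pos n C t k) \<and>
        (\<forall>t\<le>n. \<forall>k\<in>{1..<d}. walk_pos n C (n + (n - t)) (Suc k) < walk_pos n C (n + (n - t)) k)" "t \<le> 2 * n"
      moreover have "t \<le> n \<or> t = n + (n - (2 * n - t)) \<and> 2 * n - t \<le> n"
        using \<open>t \<le> 2 * n\<close> by auto
      ultimately show "\<forall>k\<in>{1..<d}. walk_pos n C t (Suc k) < walk_pos n C t k" by metis
    qed auto
    also have "\<dots> \<longleftrightarrow> A \<in> lattice_seqs n r d \<and> B \<in> lattice_seqs n r d"
    proof -
      have "walk_pos n C t (Suc k) < walk_pos n C t k \<longleftrightarrow> occ A t (Suc k) \<le> occ A t k"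
        "walk_pos n C (n + (n - t)) (Suc k) < walk_pos n C (n + (n - t)) k \<longleftrightarrow> occ B t (Suc k) \<le> occ B t k"
        if "t \<le> n" for t k
        using p1[OF that] p2[of "n - t"] that eq by auto
      then show ?thesis unfolding *[OF AB(1)] *[OF AB(2)] by simp
    qed
    finally show ?thesis .
  qed
  with walk show ?thesis by blast
qed

lemma card_not_touching_walks:
  "card {C \<in> walks n r d id. \<not> touching n d C} =
   card {(A, B). A \<in> lattice_seqs n r d \<and> B \<in> lattice_seqs n r d \<and> (\<forall>k. occ A n k = occ B n k)}"
proof -
  define Q where "Q = (\<lambda>(A, B). A \<in> lattice_seqs n r d \<and> B \<in> lattice_seqs n r d \<and>
    (\<forall>k. occ A n k = occ B n k))"
  have "{C \<in> walks n r d id. \<not> touching n d C} = {C \<in> set_seqs (2 * n) r d. Q (halves n C)}"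
  proof (rule set_eqI)
    fix C
    have "C \<in> walks n r d id \<Longrightarrow> C \<in> set_seqs (2 * n) r d" by (simp add: walks_def)
    moreover obtain A B where "halves n C = (A, B)" by (cases "halves n C")
    ultimately show "C \<in> {C \<in> walks n r d id. \<not> touching n d C} \<longleftrightarrow>
        C \<in> {C \<in> set_seqs (2 * n) r d. Q (halves n C)}"
      using halves_lattice_iff[of C n r d A B] by (auto simp: Q_def)
  qed
  also have "card \<dots> = card {z \<in> set_seqs n r d \<times> set_seqs n r d. Q z}"
    by (rule bij_betw_same_card[OF bij_betw_Collect_pullback[OF bij_betw_halves]])
  also have "{z \<in> set_seqs n r d \<times> set_seqs n r d. Q z} = {z. Q z}"
    by (auto simp: Q_def lattice_seqs_def)
  finally show ?thesis unfolding Q_def .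
qed

section \<open>Walks as pairs of words\<close>

lemma block_append:
  assumes "length a = r * n"
  shows "block r t (a @ b) = (if t < n then block r t a else block r (t - n) b)"
proof (cases "t < n")
  case True
  then show ?thesis using block_end_le[OF True, of r] assms by (simp add: block_def)
next
  case False
  then have "r * t = r * n + r * (t - n)" by (simp add: distrib_left[symmetric])
  then show ?thesis using False assms by (simp add: block_def)
qed

lemma append_in_block_words_iff:
  assumes "length a = r * n" "length b = r * n"
  shows "a @ b \<in> block_words (2 * n) r d \<longleftrightarrow> a \<in> block_words n r d \<and> b \<in> block_words n r d"
proof -
  have "(\<forall>t<2 * n. sorted_wrt (<) (block r t (a @ b))) \<longleftrightarrow>
      (\<forall>t<n. sorted_wrt (<) (block r t a)) \<and> (\<forall>t<n. sorted_wrt (<) (block r t b))"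
  proof (intro iffI conjI allI impI)
    fix t assume "\<forall>t<2 * n. sorted_wrt (<) (block r t (a @ b))" "t < n"
    then show "sorted_wrt (<) (block r t a)" "sorted_wrt (<) (block r t b)"
      using block_append[OF assms(1), of t b] block_append[OF assms(1), of "n + t" b]
      by (metis mult_2 trans_less_add1, metis add_diff_cancel_left' mult_2 nat_add_left_cancel_less
          not_add_less1)
  next
    fix t assume "(\<forall>t<n. sorted_wrt (<) (block r t a)) \<and> (\<forall>t<n. sorted_wrt (<) (block r t b))"
      "t < 2 * n"
    then show "sorted_wrt (<) (block r t (a @ b))"
      using block_append[OF assms(1), of t b] by (cases "t < n") auto
  qed
  then show ?thesis using assms by (auto simp: block_words_def)
qed

lemma W_hat'_iff:
  "(a, b) \<in> W_hat' n r d P \<longleftrightarrow> a \<in> block_words n r d \<and> b \<in> block_words n r d \<and>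
     (\<forall>k\<in>{1..d}. int (count_list a k) - int (count_list b k) = P k)"
proof (cases "length a = r * n \<and> length b = r * n")
  case True
  then show ?thesis
    using sorted_blocks_iff_ascents[of a r n] sorted_blocks_iff_ascents[of b r n]
    by (auto simp: W_hat'_def W_star_def block_words_def)
next
  case False
  then show ?thesis by (auto simp: W_hat'_def W_star_def block_words_def)
qed

text \<open>A walk \<open>a | b\<close> becomes the word \<open>a @ b\<close> of
  \<open>2 * n\<close> blocks, and the shift by \<open>- k\<close> turns the end point
  \<open>T_pt p\<close> into \<open>- p\<close>.\<close>

lemma card_W_hat'_eq_card_walks:
  "card (W_hat' n r d (T_pt p)) = card (walks n r d p)"
proof -
  define Q where "Q = (\<lambda>C. \<forall>k\<in>{1..d}. walk_pos n C (2 * n) k = - int (p k))"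
  have Q: "Q (block_sets (2 * n) r (a @ b)) \<longleftrightarrow>
      (\<forall>k\<in>{1..d}. int (count_list a k) - int (count_list b k) = T_pt p k)"
    if "length a = r * n" "length b = r * n" "a @ b \<in> block_words (2 * n) r d" for a b
  proof -
    let ?C = "block_sets (2 * n) r (a @ b)"
    have "occ ?C n k = count_list a k" "occ ?C (n + n) k = count_list a k + count_list b k" for k
      using occ_block_sets[OF that(3), of n k] occ_block_sets[OF that(3), of "n + n" k] that(1,2)
      by (simp_all add: distrib_left)
    then have "walk_pos n ?C (2 * n) k = int (count_list a k) - int (count_list b k) - int k" for k
      using occ_add[of ?C n n k] walk_pos_add_eq_occ[of n ?C n k] by (simp add: mult_2)
    then show ?thesis by (auto simp: Q_def T_pt_def)
  qed
  have "bij_betw (\<lambda>(a, b). a @ b) (W_hat' n r d (T_pt p))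
      {w \<in> block_words (2 * n) r d. Q (block_sets (2 * n) r w)}"
  proof (rule bij_betw_byWitness[where f' = "\<lambda>w. (take (r * n) w, drop (r * n) w)"])
    show "\<forall>z\<in>W_hat' n r d (T_pt p).
        (take (r * n) ((\<lambda>(a, b). a @ b) z), drop (r * n) ((\<lambda>(a, b). a @ b) z)) = z"
      by (auto simp: W_hat'_iff block_words_def)
    show "(\<lambda>(a, b). a @ b) ` W_hat' n r d (T_pt p) \<subseteq>
        {w \<in> block_words (2 * n) r d. Q (block_sets (2 * n) r w)}"
    proof clarify
      fix a b assume ab: "(a, b) \<in> W_hat' n r d (T_pt p)"
      then have len: "length a = r * n" "length b = r * n" by (auto simp: W_hat'_iff block_words_def)
      then show "a @ b \<in> block_words (2 * n) r d \<and> Q (block_sets (2 * n) r (a @ b))"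
        using ab append_in_block_words_iff[OF len] Q[OF len] by (simp add: W_hat'_iff)
    qed
    show "(\<lambda>w. (take (r * n) w, drop (r * n) w)) `
        {w \<in> block_words (2 * n) r d. Q (block_sets (2 * n) r w)} \<subseteq> W_hat' n r d (T_pt p)"
    proof clarify
      fix w assume w: "w \<in> block_words (2 * n) r d" "Q (block_sets (2 * n) r w)"
      define a b where "a = take (r * n) w" and "b = drop (r * n) w"
      have len: "length a = r * n" "length b = r * n" and ab: "a @ b = w"
        using w by (auto simp: block_words_def a_def b_def)
      show "(take (r * n) w, drop (r * n) w) \<in> W_hat' n r d (T_pt p)"
        unfolding a_def[symmetric] b_def[symmetric]
        using w append_in_block_words_iff[OF len] Q[OF len] by (simp add: W_hat'_iff ab)
    qed
  qed auto
  from bij_betw_same_card[OF this] show ?thesis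
    using bij_betw_same_card[OF bij_betw_Collect_pullback[OF bij_betw_block_sets, where Q = Q], of "2 * n" r d]
    by (simp add: walks_def Q_def)
qed

lemma g_hat_eq_signed_sum:
  "int (g_hat n r d) = (\<Sum>p | p permutes {1..d}. sign p * int (card (W_hat' n r d (T_pt p))))"
  unfolding card_W_hat'_eq_card_walks signed_walks_eq_not_touching card_not_touching_walks
    g_hat_eq_card_lattice_seqs ..

section \<open>Standard Young tableaux as words of columns\<close>

text \<open>The ballot words, also called Yamanouchi words; letters will be column numbers of
  entries.\<close>

definition lattice_words :: "nat \<Rightarrow> nat \<Rightarrow> nat list set" where
  "lattice_words m d = {w. length w = m \<and> set w \<subseteq> {1..d} \<and>
     (\<forall>p. \<forall>k\<ge>1. count_list (take p w) (Suc k) \<le> count_list (take p w) k)}"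

text \<open>Position \<open>q\<close> belongs to the entry \<open>Suc q\<close>, and columns are
  numbered from 1. The description is unique because entries do not repeat.\<close>

definition column_word :: "nat \<Rightarrow> (nat \<Rightarrow> nat \<Rightarrow> nat) \<Rightarrow> nat list" where
  "column_word m T = map (\<lambda>q. Suc (THE c. \<exists>x. T x c = Suc q)) [0..<m]"

lemma length_column_word [simp]: "length (column_word m T) = m"
  by (simp add: column_word_def)

context
  fixes m d :: nat and la :: "nat list" and T :: "nat \<Rightarrow> nat \<Rightarrow> nat"
  assumes T: "syt m d la T"
begin

text \<open>Entries are positive and the default value is 0, so the shape is the support of
  \<open>T\<close>.\<close>

lemma syt_cell_iff: "(x, c) \<in> cells la \<longleftrightarrow> 0 < T x c"
proof
  assume "(x, c) \<in> cells la"
  then have "T x c \<in> {1..m}" using T bij_betwE[of "\<lambda>(i, j). T i j" "cells la" "{1..m}"]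
    by (auto simp: syt_def)
  then show "0 < T x c" by simp
next
  assume "0 < T x c"
  then show "(x, c) \<in> cells la" using T unfolding syt_def by (metis less_irrefl)
qed

lemma syt_le: "T x c \<le> m"
proof (cases "(x, c) \<in> cells la")
  case True
  then have "T x c \<in> {1..m}" using T bij_betwE[of "\<lambda>(i, j). T i j" "cells la" "{1..m}"]
    by (auto simp: syt_def)
  then show ?thesis by simp
qed (use T in \<open>auto simp: syt_def\<close>)

lemma syt_inj: "T x c = T x' c' \<Longrightarrow> 0 < T x c \<Longrightarrow> x = x' \<and> c = c'"
  using T bij_betw_imp_inj_on[of "\<lambda>(i, j). T i j" "cells la" "{1..m}"]
    syt_cell_iff[of x c] syt_cell_iff[of x' c']
  by (auto simp: syt_def inj_on_def)

lemma syt_surj: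
  assumes "q < m"
  obtains x c where "T x c = Suc q"
proof -
  have "Suc q \<in> (\<lambda>(i, j). T i j) ` cells la"
    using T assms by (auto simp: syt_def bij_betw_def)
  then show ?thesis using that by auto
qed

lemma syt_left: "0 < T x (Suc c) \<Longrightarrow> 0 < T x c \<and> T x c < T x (Suc c)"
  using T syt_cell_iff[of x "Suc c"] syt_cell_iff[of x c] by (auto simp: syt_def cells_def)

lemma syt_up: "0 < T (Suc x) c \<Longrightarrow> 0 < T x c \<and> T x c < T (Suc x) c"
proof -
  assume "0 < T (Suc x) c"
  then have c: "(Suc x, c) \<in> cells la" by (simp add: syt_cell_iff)
  have "sorted_wrt (\<ge>) la" using T by (simp add: syt_def is_partition_def)
  then have "la ! Suc x \<le> la ! x"
    using c sorted_wrt_nth_less[of "(\<ge>)" la x "Suc x"] by (auto simp: cells_def)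
  then have "(x, c) \<in> cells la" using c by (auto simp: cells_def)
  then show ?thesis using T c by (auto simp: syt_def syt_cell_iff)
qed

lemma syt_row_less: "c < c' \<Longrightarrow> 0 < T x c' \<Longrightarrow> 0 < T x c \<and> T x c < T x c'"
proof (induction c' rule: less_Suc_induct[consumes 1])
  case (1 i)
  then show ?case using syt_left by simp
next
  case (2 i j k)
  then show ?case by auto
qed

lemma syt_column_less: "x < x' \<Longrightarrow> 0 < T x' c \<Longrightarrow> 0 < T x c \<and> T x c < T x' c"
proof (induction x' rule: less_Suc_induct[consumes 1])
  case (1 i)
  then show ?case using syt_up by simp
next
  case (2 i j k)
  then show ?case by auto
qed

lemma nth_column_word:
  assumes "T x c = Suc q"
  shows "column_word m T ! q = Suc c"
proof -
  have "(THE c. \<exists>x. T x c = Suc q) = c"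
    using assms syt_inj[of x c] by (intro the_equality) (auto, metis zero_less_Suc)
  moreover have "q < m" using syt_le[of x c] assms by simp
  ultimately show ?thesis by (simp add: column_word_def)
qed

lemma count_column_word:
  assumes "p \<le> m"
  shows "count_list (take p (column_word m T)) (Suc c) = card {x. 0 < T x c \<and> T x c \<le> p}"
  using assms
proof (induction p)
  case 0
  have "{x. 0 < T x c \<and> T x c \<le> 0} = {}" by auto
  then show ?case by (simp only: take0 count_list.simps card.empty)
next
  case (Suc p)
  obtain x0 c0 where xc: "T x0 c0 = Suc p" using syt_surj[of p] Suc.prems by auto
  have fin: "finite {x. 0 < T x c \<and> T x c \<le> p}"
    by (rule finite_subset[of _ "{..<length la}"]) (auto simp: syt_cell_iff[symmetric] cells_def)
  have "{x. 0 < T x c \<and> T x c \<le> Suc p} =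
      {x. 0 < T x c \<and> T x c \<le> p} \<union> (if c = c0 then {x0} else {})"
  proof -
    have "T x c = Suc p \<longleftrightarrow> x = x0 \<and> c = c0" for x
      using xc syt_inj[of x0 c0 x c] by auto
    moreover have "0 < T x0 c0" using xc by simp
    ultimately show ?thesis by (auto simp: le_Suc_eq)
  qed
  then have "card {x. 0 < T x c \<and> T x c \<le> Suc p} =
      card {x. 0 < T x c \<and> T x c \<le> p} + (if c = c0 then 1 else 0)"
    using fin xc by auto
  moreover have "take (Suc p) (column_word m T) = take p (column_word m T) @ [Suc c0]"
    using Suc.prems nth_column_word[OF xc] by (simp add: take_Suc_conv_app_nth)
  ultimately show ?case using Suc by auto
qed

text \<open>Columns increase downwards, so the entries up to \<open>p\<close> fill an initial
  segment of column \<open>c\<close>.\<close>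

lemma less_count_column_word_iff:
  assumes "p \<le> m"
  shows "x < count_list (take p (column_word m T)) (Suc c) \<longleftrightarrow> 0 < T x c \<and> T x c \<le> p"
proof -
  let ?X = "{x. 0 < T x c \<and> T x c \<le> p}"
  have "?X = {..<card ?X}"
  proof (rule finite_downset_eq_lessThan)
    show "finite ?X"
      by (rule finite_subset[of _ "{..<length la}"]) (auto simp: syt_cell_iff[symmetric] cells_def)
    show "y \<in> ?X" if "x \<in> ?X" "y < x" for x y
      using syt_column_less[OF that(2), of c] that(1) by auto
  qed
  then have "x \<in> ?X \<longleftrightarrow> x < card ?X" by blast
  then show ?thesis using count_column_word[OF assms] by simp
qed

lemma column_word_in_lattice_words: "column_word m T \<in> lattice_words m d"
proof -
  have "set (column_word m T) \<subseteq> {1..d}"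
  proof
    fix k assume "k \<in> set (column_word m T)"
    then obtain q where q: "q < m" "k = column_word m T ! q" by (auto simp: in_set_conv_nth)
    then obtain x c where xc: "T x c = Suc q" using syt_surj by blast
    then have "(x, c) \<in> cells la" by (simp add: syt_cell_iff)
    then have "c < d" using T by (auto simp: syt_def cells_def intro: less_le_trans)
    then show "k \<in> {1..d}" using q nth_column_word[OF xc] by simp
  qed
  moreover have "count_list (take p (column_word m T)) (Suc k) \<le> count_list (take p (column_word m T)) k"
    if k: "k \<ge> 1" for p k
  proof -
    have *: "count_list (take p (column_word m T)) (Suc k) \<le> count_list (take p (column_word m T)) k"
      if "p \<le> m" for p
    proof (rule ccontr)
      assume "\<not> ?thesis"
      moreover obtain c where "k = Suc c" using k by (cases k) auto
      \<comment> \<open>In the row indexed by the smaller count, an entry at most \<open>p\<close>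
        would have an entry larger than \<open>p\<close> directly to its left.\<close>
      ultimately have "count_list (take p (column_word m T)) (Suc c) <
          count_list (take p (column_word m T)) (Suc (Suc c))" by simp
      then show False
        using less_count_column_word_iff[OF that, of _ c] less_count_column_word_iff[OF that, of _ "Suc c"]
          syt_left by (meson less_irrefl less_le_trans less_imp_le)
    qed
    show ?thesis
    proof (cases "p \<le> m")
      case False
      then show ?thesis using *[of m] by simp
    qed (use * in auto)
  qed
  ultimately show ?thesis by (simp add: lattice_words_def)
qed

text \<open>If \<open>Suc (Suc q)\<close> stood weakly above and weakly left of
  \<open>Suc q\<close>, it would be at most \<open>Suc q\<close>. If it stood strictly below and
  strictly right, the cell \<open>(x, y')\<close> would hold a value strictly between two
  consecutive numbers.\<close>

lemma syt_weakly_above_iff: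
  assumes "T x y = Suc q" "T x' y' = Suc (Suc q)"
  shows "x' \<le> x \<longleftrightarrow> y < y'"
proof
  assume "x' \<le> x"
  show "y < y'"
  proof (rule ccontr)
    assume "\<not> y < y'"
    then have "T x' y' \<le> T x' y" "0 < T x' y"
      using syt_row_less[of y' y x'] syt_column_less[of x' x y] assms \<open>x' \<le> x\<close> by (auto simp: le_less not_less)
    moreover have "T x' y \<le> T x y"
      using syt_column_less[of x' x y] assms \<open>x' \<le> x\<close> by (auto simp: le_less)
    ultimately show False using assms by simp
  qed
next
  assume "y < y'"
  show "x' \<le> x"
  proof (rule ccontr)
    assume "\<not> x' \<le> x"
    then have "0 < T x y'" "T x y' < T x' y'"
      using syt_column_less[of x x' y'] assms by auto
    moreover have "T x y < T x y'" using syt_row_less[OF \<open>y < y'\<close>] calculation by auto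
    ultimately show False using assms by simp
  qed
qed

lemma cond_T_hat_iff_ascents:
  assumes "m = r * n"
  shows "cond_T_hat n r T \<longleftrightarrow>
    (\<forall>i\<in>{1..n}. \<forall>s. 1 \<le> s \<and> s < r \<longrightarrow>
       column_word m T ! (r * (i - 1) + s - 1) < column_word m T ! (r * (i - 1) + s))"
  unfolding cond_T_hat_def
proof (intro ball_cong all_cong refl)
  fix i s assume its: "i \<in> {1..n}" "1 \<le> s \<and> s < r"
  \<comment> \<open>The list position of the entry \<open>r * (i - 1) + s\<close>.\<close>
  define q where "q = r * (i - 1) + s - 1"
  have q: "r * (i - 1) + s = Suc q" using its by (simp add: q_def)
  have "r * (i - 1) + r \<le> r * n" by (rule block_end_le) (use its in auto)
  then have "Suc q < m" using its q assms by linarith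
  then obtain x y x' y' where xy: "T x y = Suc q" "T x' y' = Suc (Suc q)"
    using syt_surj[of q] syt_surj[of "Suc q"] by (metis Suc_lessD)
  have "(\<forall>x y x' y'. T x y = Suc q \<and> T x' y' = Suc q + 1 \<longrightarrow> x' \<le> x) \<longleftrightarrow> x' \<le> x"
    using xy syt_inj by (metis Suc_eq_plus1 zero_less_Suc)
  also have "\<dots> \<longleftrightarrow> column_word m T ! q < column_word m T ! Suc q"
    using syt_weakly_above_iff[OF xy] nth_column_word[OF xy(1)] nth_column_word[OF xy(2)] by simp
  finally show "(\<forall>x y x' y'. T x y = r * (i - 1) + s \<and> T x' y' = r * (i - 1) + s + 1 \<longrightarrow> x' \<le> x) \<longleftrightarrow>
      column_word m T ! (r * (i - 1) + s - 1) < column_word m T ! (r * (i - 1) + s)"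
    unfolding q by simp
qed

lemma cells_eq_count: "cells la = {(x, c). x < count_list (column_word m T) (Suc c)}"
  using less_count_column_word_iff[of m] syt_le by (auto simp: syt_cell_iff)

end

text \<open>A partition has no zero part, so its length is visible in column 0 of the
  diagram.\<close>

lemma partition_eqI:
  assumes "is_partition la" "is_partition mu" "cells la = cells mu"
  shows "la = mu"
proof -
  have len: "x < length la \<longleftrightarrow> (x, 0) \<in> cells la" if "is_partition la" for x la
    using that by (auto simp: is_partition_def cells_def in_set_conv_nth intro!: gr0I)
  have "length la = length mu"
    by (rule less_nat_iff_imp_eq) (simp add: len assms)
  moreover have "la ! x = mu ! x" if "x < length la" for x
  proof (rule less_nat_iff_imp_eq)
    fix c
    have "c < la ! x \<longleftrightarrow> (x, c) \<in> cells la" using that by (simp add: cells_def)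
    also have "\<dots> \<longleftrightarrow> c < mu ! x"
      using that \<open>length la = length mu\<close> unfolding assms(3) by (simp add: cells_def)
    finally show "c < la ! x \<longleftrightarrow> c < mu ! x" .
  qed
  ultimately show ?thesis by (rule nth_equalityI)
qed

lemma same_shape_iff_same_counts:
  assumes "syt m d la P" "syt m d mu Q"
  shows "la = mu \<longleftrightarrow> (\<forall>k. count_list (column_word m P) k = count_list (column_word m Q) k)"
proof
  assume "la = mu"
  show "\<forall>k. count_list (column_word m P) k = count_list (column_word m Q) k"
  proof
    fix k
    show "count_list (column_word m P) k = count_list (column_word m Q) k"
    proof (cases k)
      case 0
      have "0 \<notin> set (column_word m P)" "0 \<notin> set (column_word m Q)"
        by (auto simp: column_word_def)
      then show ?thesis using 0 by (metis count_notin)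
    next
      case (Suc c)
      show ?thesis
        using cells_eq_count[OF assms(1)] cells_eq_count[OF assms(2)] \<open>la = mu\<close>
        by (intro less_nat_iff_imp_eq) (auto simp: Suc set_eq_iff)
    qed
  qed
next
  assume "\<forall>k. count_list (column_word m P) k = count_list (column_word m Q) k"
  then have "cells la = cells mu"
    using cells_eq_count[OF assms(1)] cells_eq_count[OF assms(2)] by simp
  then show "la = mu" using assms by (intro partition_eqI) (auto simp: syt_def)
qed

section \<open>Tableaux from lattice words\<close>

text \<open>The least prefix length is the position, counted from 1, of occurrence number
  \<open>x + 1\<close> of the letter \<open>Suc c\<close>.\<close>

definition word_tableau :: "nat list \<Rightarrow> nat \<Rightarrow> nat \<Rightarrow> nat" where
  "word_tableau w x c = (if x < count_list w (Suc c)
     then LEAST p. x < count_list (take p w) (Suc c) else 0)"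

definition word_shape :: "nat list \<Rightarrow> nat list" where
  "word_shape w = map (\<lambda>x. card {c. x < count_list w (Suc c)}) [0..<count_list w 1]"

lemma count_list_take_mono: "p \<le> p' \<Longrightarrow> count_list (take p w) k \<le> count_list (take p' w) k"
  by (metis count_list_append le_add1 le_add_diff_inverse take_add)

text \<open>Prefix counts grow with the prefix, so a prefix is long enough as soon as it reaches the
  least one. This is the counterpart of \<open>less_count_column_word_iff\<close>.\<close>

lemma word_tableau_le_iff:
  "0 < word_tableau w x c \<and> word_tableau w x c \<le> p \<longleftrightarrow> x < count_list (take p w) (Suc c)"
proof
  assume *: "0 < word_tableau w x c \<and> word_tableau w x c \<le> p"
  then have "x < count_list w (Suc c)" by (auto simp: word_tableau_def split: if_splits)
  then have "x < count_list (take (length w) w) (Suc c)" by simp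
  then have "x < count_list (take (LEAST p. x < count_list (take p w) (Suc c)) w) (Suc c)"
    by (rule LeastI)
  then have "x < count_list (take (word_tableau w x c) w) (Suc c)"
    using \<open>x < count_list w (Suc c)\<close> by (simp add: word_tableau_def)
  also have "\<dots> \<le> count_list (take p w) (Suc c)" using * by (intro count_list_take_mono) simp
  finally show "x < count_list (take p w) (Suc c)" .
next
  assume *: "x < count_list (take p w) (Suc c)"
  also have "\<dots> \<le> count_list (take (max p (length w)) w) (Suc c)" by (rule count_list_take_mono) simp
  finally have x: "x < count_list w (Suc c)" by simp
  have "x < count_list (take (LEAST p. x < count_list (take p w) (Suc c)) w) (Suc c)"
    using * by (rule LeastI)
  then have "(LEAST p. x < count_list (take p w) (Suc c)) \<noteq> 0" by (metis count_list.simps(1) not_less0 take0)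
  moreover have "(LEAST p. x < count_list (take p w) (Suc c)) \<le> p" using * by (rule Least_le)
  ultimately show "0 < word_tableau w x c \<and> word_tableau w x c \<le> p" using x by (simp add: word_tableau_def)
qed

text \<open>Equality with \<open>Suc q\<close> means at most \<open>Suc q\<close> but not at most
  \<open>q\<close>: the count passes \<open>x\<close> exactly at position \<open>q\<close>.\<close>

lemma word_tableau_eq_iff:
  assumes "q < length w"
  shows "word_tableau w x c = Suc q \<longleftrightarrow> w ! q = Suc c \<and> x = count_list (take q w) (Suc c)"
proof -
  have "word_tableau w x c = Suc q \<longleftrightarrow>
      (0 < word_tableau w x c \<and> word_tableau w x c \<le> Suc q) \<and>
      \<not> (0 < word_tableau w x c \<and> word_tableau w x c \<le> q)" by auto
  also have "\<dots> \<longleftrightarrow> x < count_list (take (Suc q) w) (Suc c) \<and> \<not> x < count_list (take q w) (Suc c)"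
    by (simp only: word_tableau_le_iff)
  also have "\<dots> \<longleftrightarrow> w ! q = Suc c \<and> x = count_list (take q w) (Suc c)"
    using assms by (auto simp: take_Suc_conv_app_nth)
  finally show ?thesis .
qed

context
  fixes m d :: nat and w :: "nat list"
  assumes w: "w \<in> lattice_words m d"
begin

lemma lattice_word_simps: "length w = m" "set w \<subseteq> {1..d}"
  "count_list (take p w) (Suc (Suc c)) \<le> count_list (take p w) (Suc c)"
  using w by (auto simp: lattice_words_def)

lemma cells_word_shape: "cells (word_shape w) = {(x, c). x < count_list w (Suc c)}"
  and word_shape_le: "\<forall>i<length (word_shape w). word_shape w ! i \<le> d"
  and is_partition_word_shape: "is_partition (word_shape w)"
proof -
  have dec: "count_list w (Suc c') \<le> count_list w (Suc c)" if "c \<le> c'" for c c'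
    by (rule lift_Suc_antimono_le[of "\<lambda>c. count_list w (Suc c)", OF _ that])
      (use lattice_word_simps(3)[of "length w"] in simp)
  have sub: "{c. x < count_list w (Suc c)} \<subseteq> {..<d}" for x
  proof
    fix c assume "c \<in> {c. x < count_list w (Suc c)}"
    then have "Suc c \<in> set w" by (metis count_notin mem_Collect_eq not_less0)
    then show "c \<in> {..<d}" using lattice_word_simps(2) by auto
  qed
  have fin: "finite {c. x < count_list w (Suc c)}" for x
    using sub by (rule finite_subset) simp
  have iff: "c < card {c. x < count_list w (Suc c)} \<longleftrightarrow> x < count_list w (Suc c)" for x c
  proof -
    have "{c. x < count_list w (Suc c)} = {..<card {c. x < count_list w (Suc c)}}"
      by (rule finite_downset_eq_lessThan[OF fin]) (auto intro: less_le_trans[OF _ dec])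
    then have "c \<in> {c. x < count_list w (Suc c)} \<longleftrightarrow> c < card {c. x < count_list w (Suc c)}" by blast
    then show ?thesis by simp
  qed
  have "x < count_list w 1" if "x < count_list w (Suc c)" for x c
    using that dec[of 0 c] by simp
  then show "cells (word_shape w) = {(x, c). x < count_list w (Suc c)}"
    by (auto simp: cells_def word_shape_def iff)
  have "card {c. x < count_list w (Suc c)} \<le> d" for x
    using card_mono[OF _ sub[of x]] by simp
  then show "\<forall>i<length (word_shape w). word_shape w ! i \<le> d" by (simp add: word_shape_def)
  show "is_partition (word_shape w)"
    unfolding is_partition_def
  proof
    have "card {c. y < count_list w (Suc c)} \<le> card {c. x < count_list w (Suc c)}" if "x < y" for x y
      by (rule card_mono[OF fin]) (use that in auto)
    then show "sorted_wrt (\<ge>) (word_shape w)"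
      by (simp add: sorted_wrt_iff_nth_less word_shape_def)
    have "0 < card {c. x < count_list w (Suc c)}" if "x < count_list w 1" for x
      using iff[of 0 x] that by simp
    then show "0 \<notin> set (word_shape w)" by (fastforce simp: word_shape_def)
  qed
qed

text \<open>Columns increase because later occurrences of a letter have larger positions. Rows
  increase because, by the lattice condition, each occurrence of a letter \<open>Suc (Suc c)\<close>
  is preceded by the occurrence of \<open>Suc c\<close> with the same number.\<close>

lemma syt_word_tableau: "syt m d (word_shape w) (word_tableau w)"
  unfolding syt_def
proof (intro conjI allI impI)
  note cell = cells_word_shape
  have tab_pos: "0 < word_tableau w x c \<longleftrightarrow> x < count_list w (Suc c)"
    and le: "word_tableau w x c \<le> m" for x c
    using word_tableau_le_iff[of w x c m] lattice_word_simps(1)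
    by (auto simp: word_tableau_def split: if_splits)
  have nth: "w ! q = Suc c \<and> x = count_list (take q w) (Suc c)" if "word_tableau w x c = Suc q" for q x c
    using word_tableau_eq_iff[of q w x c] le[of x c] that lattice_word_simps(1) by simp
  show "is_partition (word_shape w)" by (rule is_partition_word_shape)
  show "word_shape w ! i \<le> d" if "i < length (word_shape w)" for i
    using word_shape_le that by blast
  show "bij_betw (\<lambda>(i, j). word_tableau w i j) (cells (word_shape w)) {1..m}"
  proof (rule bij_betw_imageI)
    show "inj_on (\<lambda>(i, j). word_tableau w i j) (cells (word_shape w))"
    proof (rule inj_onI, clarify)
      fix x c x' c' assume *: "(x, c) \<in> cells (word_shape w)" "word_tableau w x c = word_tableau w x' c'"
      then have "0 < word_tableau w x c" using tab_pos[of x c] cell by simp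
      then obtain q where "word_tableau w x c = Suc q" using gr0_implies_Suc by blast
      then show "x = x' \<and> c = c'" using nth[of x c q] nth[of x' c' q] * by auto
    qed
    show "(\<lambda>(i, j). word_tableau w i j) ` cells (word_shape w) = {1..m}"
    proof (intro subset_antisym subsetI)
      fix p assume "p \<in> (\<lambda>(i, j). word_tableau w i j) ` cells (word_shape w)"
      then show "p \<in> {1..m}" using cell tab_pos le by (auto simp: Suc_le_eq)
    next
      fix p assume "p \<in> {1..m}"
      then obtain q where q: "p = Suc q" "q < length w"
        using lattice_word_simps(1) by (cases p) auto
      then have "w ! q \<in> {1..d}" using lattice_word_simps(2) nth_mem by blast
      then obtain c where "w ! q = Suc c" by (cases "w ! q") auto
      then have "word_tableau w (count_list (take q w) (Suc c)) c = p"
        using word_tableau_eq_iff q by simp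
      then show "p \<in> (\<lambda>(i, j). word_tableau w i j) ` cells (word_shape w)"
        using tab_pos[of "count_list (take q w) (Suc c)" c] q cell
        by (auto intro!: rev_image_eqI[of "(count_list (take q w) (Suc c), c)"])
    qed
  qed
  show "word_tableau w x c = 0" if "(x, c) \<notin> cells (word_shape w)" for x c
    using that cell by (simp add: word_tableau_def)
  show "word_tableau w x c < word_tableau w x (c + 1)" if "(x, c + 1) \<in> cells (word_shape w)" for x c
  proof -
    define p where "p = word_tableau w x (Suc c)"
    have p: "0 < p" using that cell tab_pos by (simp add: p_def)
    then obtain q where q: "p = Suc q" by (cases p) auto
    have "x < count_list (take p w) (Suc (Suc c))"
      using word_tableau_le_iff[of w x "Suc c" p] p by (simp add: p_def)
    also have "\<dots> \<le> count_list (take p w) (Suc c)" by (rule lattice_word_simps)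
    finally have "word_tableau w x c \<le> p" using word_tableau_le_iff by blast
    \<comment> \<open>One position of \<open>w\<close> cannot hold two different letters.\<close>
    moreover have "word_tableau w x c \<noteq> p"
      using nth[of x c q] nth[of x "Suc c" q] q p_def by auto
    ultimately show ?thesis by (simp add: p_def)
  qed
  show "word_tableau w x c < word_tableau w (x + 1) c" if "(x + 1, c) \<in> cells (word_shape w)" for x c
  proof -
    define p where "p = word_tableau w (Suc x) c"
    have p: "0 < p" using that cell tab_pos by (simp add: p_def)
    then obtain q where q: "p = Suc q" by (cases p) auto
    then have "x < count_list (take q w) (Suc c)" using nth[of "Suc x" c q] by (simp add: p_def)
    then have "word_tableau w x c \<le> q" using word_tableau_le_iff by blast
    then show ?thesis using q by (simp add: p_def)
  qed
qed

lemma column_word_word_tableau: "column_word m (word_tableau w) = w"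
proof (rule nth_equalityI)
  show "length (column_word m (word_tableau w)) = length w" by (simp add: lattice_word_simps)
  fix q assume "q < length (column_word m (word_tableau w))"
  then have "q < m" by simp
  then obtain x c where xc: "word_tableau w x c = Suc q" using syt_surj[OF syt_word_tableau] by blast
  then show "column_word m (word_tableau w) ! q = w ! q"
    using nth_column_word[OF syt_word_tableau xc] word_tableau_eq_iff[of q w x c] \<open>q < m\<close>
    by (simp add: lattice_word_simps)
qed

end

lemma bij_betw_column_word:
  "bij_betw (\<lambda>(la, T). column_word m T) {(la, T). syt m d la T} (lattice_words m d)"
proof (rule bij_betw_imageI)
  show "inj_on (\<lambda>(la, T). column_word m T) {(la, T). syt m d la T}"
  proof (rule inj_onI, clarify)
    fix la P mu Q assume P: "syt m d la P" and Q: "syt m d mu Q"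
      and eq: "column_word m P = column_word m Q"
    have "la = mu" using same_shape_iff_same_counts[OF P Q] eq by simp
    moreover have "P x c = Q x c" for x c
    proof -
      have iff: "0 < P x c \<and> P x c \<le> p \<longleftrightarrow> 0 < Q x c \<and> Q x c \<le> p" if "p \<le> m" for p
        using less_count_column_word_iff[OF P that, of x c] less_count_column_word_iff[OF Q that, of x c] eq
        by simp
      \<comment> \<open>Taking \<open>p\<close> to be either of the two values bounds each by the
        other and decides whether they vanish.\<close>
      show ?thesis
        using iff[of "P x c"] iff[of "Q x c"] syt_le[OF P, of x c] syt_le[OF Q, of x c] by auto
    qed
    ultimately show "la = mu \<and> P = Q" by auto
  qed
  show "(\<lambda>(la, T). column_word m T) ` {(la, T). syt m d la T} = lattice_words m d"
  proof (intro subset_antisym subsetI)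
    fix w assume w: "w \<in> lattice_words m d"
    show "w \<in> (\<lambda>(la, T). column_word m T) ` {(la, T). syt m d la T}"
      using syt_word_tableau[OF w] column_word_word_tableau[OF w]
      by (intro rev_image_eqI[of "(word_shape w, word_tableau w)"]) auto
  qed (auto intro: column_word_in_lattice_words)
qed

section \<open>Tableaux with Condition \<open>T\<close>-hat and lattice sequences\<close>

lemma block_prefix_closed:
  assumes "sorted_wrt (<) b" "Suc k \<in> set (take s b)" "k \<in> set b"
  shows "k \<in> set (take s b)"
proof -
  obtain i where i: "i < length b" "i < s" "b ! i = Suc k"
    using assms(2) by (auto simp: in_set_conv_nth)
  obtain j where j: "j < length b" "b ! j = k" using assms(3) by (auto simp: in_set_conv_nth)
  have "j < i"
    using sorted_wrt_nth_less[OF assms(1), of i j] i j by (cases i j rule: linorder_cases) auto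
  then show ?thesis using i j by (auto simp: in_set_conv_nth intro!: exI[of _ j])
qed

text \<open>The lattice condition at the two ends of a block implies it inside: where \<open>Suc k\<close> occurs before \<open>k\<close>
  in an increasing block, \<open>k\<close> does not occur in it at all.\<close>
lemma lattice_seqs_block_sets_iff:
  assumes w: "w \<in> block_words n r d"
  shows "block_sets n r w \<in> lattice_seqs n r d \<longleftrightarrow> w \<in> lattice_words (r * n) d"
proof
  assume "w \<in> lattice_words (r * n) d"
  then show "block_sets n r w \<in> lattice_seqs n r d"
    using block_sets_in_set_seqs[OF w] occ_block_sets[OF w] by (simp add: lattice_seqs_def lattice_words_def)
next
  assume L: "block_sets n r w \<in> lattice_seqs n r d"
  have len: "length w = r * n" using w by (simp add: block_words_def)
  have lat: "count_list (take (r * t) w) (Suc k) \<le> count_list (take (r * t) w) k"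
    if "t \<le> n" "k \<ge> 1" for t k
    using L that unfolding lattice_seqs_def occ_block_sets[OF w that(1), symmetric] by blast
  have "count_list (take p w) (Suc k) \<le> count_list (take p w) k" if k: "k \<ge> 1" for p k
  proof (cases "p < r * n")
    case False
    then show ?thesis using lat[OF order_refl k] len by simp
  next
    case True
    define t s where "t = p div r" and "s = p mod r"
    have t: "t < n" using True by (simp add: t_def less_mult_imp_div_less mult.commute)
    have "0 < r" using True by (cases r) auto
    have p: "p = r * t + s" and s: "s < r" using \<open>0 < r\<close> by (simp_all add: t_def s_def)
    let ?b = "block r t w"
    have b: "sorted_wrt (<) ?b" using w t by (simp add: block_words_def)
    then have d: "distinct ?b" by (simp add: strict_sorted_iff)
    have tk: "take p w = take (r * t) w @ take s ?b"
      unfolding p take_add block_def using s by (simp add: min_def)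
    \<comment> \<open>If \<open>k\<close> is missing from the block, its count at \<open>p\<close>
      is already that at the block end, where the count of \<open>Suc k\<close> is at least as large
      as at \<open>p\<close>.\<close>
    have "count_list (take (r * Suc t) w) (Suc k) \<le> count_list (take (r * Suc t) w) k"
      using lat[of "Suc t" k] t k by simp
    then show ?thesis
      using lat[of t k] t k block_prefix_closed[OF b, of k s] d in_set_takeD[of "Suc k" s ?b]
      unfolding take_Suc_block tk
      by (auto simp: count_list_distinct split: if_splits)
  qed
  then show "w \<in> lattice_words (r * n) d"
    using w by (simp add: block_words_def lattice_words_def)
qed

lemma bij_betw_syt_lattice_seqs:
  "bij_betw (\<lambda>(la, T). block_sets n r (column_word (r * n) T))
     {(la, T). syt (r * n) d la T \<and> cond_T_hat n r T} (lattice_seqs n r d)"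
proof -
  let ?m = "r * n"
  have cond: "cond_T_hat n r T \<longleftrightarrow> column_word ?m T \<in> block_words n r d" if "syt ?m d la T" for la T
    using cond_T_hat_iff_ascents[OF that refl] sorted_blocks_iff_ascents[of "column_word ?m T" r n]
      column_word_in_lattice_words[OF that] by (simp add: block_words_def lattice_words_def)
  have "bij_betw (\<lambda>(la, T). column_word ?m T)
      {z \<in> {(la, T). syt ?m d la T}. (case z of (la, T) \<Rightarrow> column_word ?m T) \<in> block_words n r d}
      {w \<in> lattice_words ?m d. w \<in> block_words n r d}"
    by (rule bij_betw_Collect_pullback[OF bij_betw_column_word])
  also have "{z \<in> {(la, T). syt ?m d la T}. (case z of (la, T) \<Rightarrow> column_word ?m T) \<in> block_words n r d} =
      {(la, T). syt ?m d la T \<and> cond_T_hat n r T}"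
    using cond by auto
  finally have 1: "bij_betw (\<lambda>(la, T). column_word ?m T)
      {(la, T). syt ?m d la T \<and> cond_T_hat n r T} {w \<in> lattice_words ?m d. w \<in> block_words n r d}" .
  have "bij_betw (block_sets n r) {w \<in> block_words n r d. block_sets n r w \<in> lattice_seqs n r d}
      {C \<in> set_seqs n r d. C \<in> lattice_seqs n r d}"
    by (rule bij_betw_Collect_pullback[OF bij_betw_block_sets])
  also have "{w \<in> block_words n r d. block_sets n r w \<in> lattice_seqs n r d} =
      {w \<in> lattice_words ?m d. w \<in> block_words n r d}"
    using lattice_seqs_block_sets_iff by blast
  also have "{C \<in> set_seqs n r d. C \<in> lattice_seqs n r d} = lattice_seqs n r d"
    by (auto simp: lattice_seqs_def)
  finally have "bij_betw (block_sets n r \<circ> (\<lambda>(la, T). column_word ?m T))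
      {(la, T). syt ?m d la T \<and> cond_T_hat n r T} (lattice_seqs n r d)"
    by (rule bij_betw_trans[OF 1])
  then show ?thesis by (simp add: comp_def case_prod_unfold)
qed

text \<open>The final counts are the column lengths of the shape, so a common shape amounts to equal
  counts.\<close>

lemma card_tableau_pairs:
  "card {(la, P, Q). syt (r * n) d la P \<and> syt (r * n) d la Q \<and> cond_T_hat n r P \<and> cond_T_hat n r Q} =
   card {(A, B). A \<in> lattice_seqs n r d \<and> B \<in> lattice_seqs n r d \<and> (\<forall>k. occ A n k = occ B n k)}"
proof -
  let ?S = "{(la, T). syt (r * n) d la T \<and> cond_T_hat n r T}"
  let ?f = "\<lambda>(la :: nat list, T). block_sets n r (column_word (r * n) T)"
  have "bij_betw (\<lambda>(la, P, Q). ((la, P), (la, Q)))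
      {(la, P, Q). syt (r * n) d la P \<and> syt (r * n) d la Q \<and> cond_T_hat n r P \<and> cond_T_hat n r Q}
      {(y, z). y \<in> ?S \<and> z \<in> ?S \<and> fst y = fst z}"
    by (rule bij_betw_byWitness[where f' = "\<lambda>(y, z). (fst y, snd y, snd z)"]) auto
  moreover have "bij_betw (map_prod ?f ?f) {(y, z). y \<in> ?S \<and> z \<in> ?S \<and> fst y = fst z}
      {(A, B). A \<in> lattice_seqs n r d \<and> B \<in> lattice_seqs n r d \<and> (\<forall>k. occ A n k = occ B n k)}"
  proof (rule bij_betw_related_pairs[OF bij_betw_syt_lattice_seqs])
    fix y z assume yz: "y \<in> ?S" "z \<in> ?S"
    obtain la P mu Q where [simp]: "y = (la, P)" "z = (mu, Q)" by (cases y, cases z)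
    have bw: "column_word (r * n) T \<in> block_words n r d"
      if "syt (r * n) d la T" "cond_T_hat n r T" for la T
      using cond_T_hat_iff_ascents[OF that(1) refl] that(2)
        sorted_blocks_iff_ascents[of "column_word (r * n) T" r n]
        column_word_in_lattice_words[OF that(1)] by (simp add: block_words_def lattice_words_def)
    have "occ (?f y) n k = count_list (column_word (r * n) P) k"
      "occ (?f z) n k = count_list (column_word (r * n) Q) k" for k
      using occ_block_sets[OF bw order_refl] yz by auto
    then show "fst y = fst z \<longleftrightarrow> (\<forall>k. occ (?f y) n k = occ (?f z) n k)"
      using same_shape_iff_same_counts[of "r * n" d la P mu Q] yz by simp
  qed
  ultimately show ?thesis by (metis (no_types, lifting) bij_betw_same_card)
qed

theorem theorem4:
  fixes n r d :: nat
  assumes "1 \<le> n" and "1 \<le> r"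
  shows "g_hat n r d =
           card {(la, P, Q). syt (r * n) d la P \<and> syt (r * n) d la Q \<and>
                             cond_T_hat n r P \<and> cond_T_hat n r Q}
       \<and> int (g_hat n r d) =
           (\<Sum>p | p permutes {1..d}. sign p * int (card (W_hat' n r d (T_pt p))))"
  using g_hat_eq_card_lattice_seqs[of n r d] card_tableau_pairs[of r n d] g_hat_eq_signed_sum[of n r d]
  by simp

end
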